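(* Let $\xi$ be an integrable random vector in $\mathbb{R}^d$ and, for $j=1,\dots,d$, let $M_j$ be a $d\times j$ random matrix whose $j$ columns are i.i.d. copies of $\xi$. Then $$V_j(\mathbf{E}[0,\xi])=\frac{1}{j!}\,\mathbf{E}\sqrt{\det M_j^{T}M_j},\qquad j=1,\dots,d,$$ where $V_j$ denotes the $j$-th intrinsic volume.
   Context: A convex body is a non-empty compact convex set in $\mathbb{R}^d$; its support function is $h(K,u)=\sup\{\langle x,u\rangle:x\in K\}$, $u\in\mathbb{R}^d$. $[0,\xi]$ is the random segment with end-points $0$ and $\xi$, and $\mathbf{E}[0,\xi]$ is its selection expectation, i.e. the convex body with support function $u\mapsto\mathbf{E}\,h([0,\xi],u)$. The intrinsic volumes $V_0,\dots,V_d$ of a convex body $K$ are determined by the Steiner formula $V_d(K+tB^d)=\sum_{j=0}^d t^{d-j}\kappa_{d-j}V_j(K)$, $t\ge 0$, where $V_d$ is Lebesgue measure, $B^d$ is the centred closed unit ball in $\mathbb{R}^d$, the sum of sets is the Minkowski sum, and $\kappa_m$ is the $m$-dimensional volume of the unit ball $B^m$ (with $\kappa_0=1$). *)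

theory Defs
  imports "HOL-Probability.Probability"
begin

definition convex_body :: "'a::euclidean_space set \<Rightarrow> bool" where
  "convex_body K \<longleftrightarrow> K \<noteq> {} \<and> compact K \<and> convex K"

definition support_function :: "'a::euclidean_space set \<Rightarrow> 'a \<Rightarrow> real" where
  "support_function K u = (SUP x\<in>K. x \<bullet> u)"

text \<open>The selection expectation of a random convex body. At most one convex body has a prescribed
  support function, see \<open>selection_expectation_eqI\<close> below.\<close>

definition selection_expectation :: "'w measure \<Rightarrow> ('w \<Rightarrow> 'a::euclidean_space set) \<Rightarrow> 'a set" where
  "selection_expectation M X =
     (THE K. convex_body K \<and>
        (\<forall>u. support_function K u = prob_space.expectation M (\<lambda>\<omega>. support_function (X \<omega>) u)))"

text \<open>\<open>intrinsic_volume K j\<close> is $V_j(K)$. The sequence of intrinsic volumes is read off from the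
  Steiner formula, which fixes the entries $0,\dots,d$; the remaining entries are $0$ by convention.
  The number $\kappa_m$ is \<open>unit_ball_vol m\<close>, and \<open>+\<close> on sets is the Minkowski sum.\<close>

definition steiner_formula :: "'a::euclidean_space set \<Rightarrow> (nat \<Rightarrow> real) \<Rightarrow> bool" where
  "steiner_formula K V \<longleftrightarrow>
     (\<forall>t\<ge>0. measure lebesgue (K + (\<lambda>x. t *\<^sub>R x) ` cball 0 1) =
        (\<Sum>j\<le>DIM('a). t ^ (DIM('a) - j) * unit_ball_vol (real (DIM('a) - j)) * V j))"

definition intrinsic_volume :: "'a::euclidean_space set \<Rightarrow> nat \<Rightarrow> real" where
  "intrinsic_volume K = (THE V. steiner_formula K V \<and> (\<forall>j>DIM('a). V j = 0))"

lemma convex_body_subsetI: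
  assumes K: "convex_body K" and L: "convex_body L"
    and eq: "support_function K = support_function L"
  shows "K \<subseteq> L"
proof
  fix z assume z: "z \<in> K"
  show "z \<in> L"
  proof (rule ccontr)
    assume "z \<notin> L"
    then obtain a b where ab: "a \<bullet> z < b" "\<And>x. x \<in> L \<Longrightarrow> a \<bullet> x > b"
      using separating_hyperplane_closed_point[of L z] L
      by (auto simp: convex_body_def compact_imp_closed)
    have "bdd_above ((\<lambda>x. x \<bullet> (- a)) ` K)"
      using K unfolding convex_body_def
      by (intro bounded_imp_bdd_above compact_imp_bounded compact_continuous_image
          continuous_intros) auto
    with z have "z \<bullet> (- a) \<le> support_function K (- a)"
      unfolding support_function_def by (rule cSUP_upper)
    also have "\<dots> = support_function L (- a)"
      by (simp add: eq)
    also have "\<dots> \<le> - b"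
      unfolding support_function_def using L ab(2)
      by (intro cSUP_least) (auto simp: convex_body_def inner_commute less_imp_le)
    finally show False
      using ab(1) by (simp add: inner_commute)
  qed
qed

lemma selection_expectation_eqI:
  assumes "convex_body K"
    and "\<And>u. support_function K u = prob_space.expectation M (\<lambda>\<omega>. support_function (X \<omega>) u)"
  shows "selection_expectation M X = K"
  unfolding selection_expectation_def
proof (rule the_equality)
  fix L
  assume "convex_body L \<and>
    (\<forall>u. support_function L u = prob_space.expectation M (\<lambda>\<omega>. support_function (X \<omega>) u))"
  with assms show "L = K"
    by (intro subset_antisym convex_body_subsetI) auto
qed (use assms in auto)

lemma steiner_formula_unique:
  fixes K :: "'a::euclidean_space set"
  assumes V: "steiner_formula K V" and W: "steiner_formula K W" and j: "j \<le> DIM('a)"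
  shows "V j = W j"
proof -
  define c where "c i = unit_ball_vol (real i) * (V (DIM('a) - i) - W (DIM('a) - i))" for i
  have "(\<Sum>i\<le>DIM('a). c i * t ^ i) = 0" if "t \<ge> 0" for t
  proof -
    have "(\<Sum>i\<le>DIM('a). c i * t ^ i) = (\<Sum>i\<le>DIM('a). c (DIM('a) - i) * t ^ (DIM('a) - i))"
      by (rule sum.reindex_bij_witness[of _ "\<lambda>i. DIM('a) - i" "\<lambda>i. DIM('a) - i"]) auto
    also have "\<dots> = (\<Sum>i\<le>DIM('a). t ^ (DIM('a) - i) * unit_ball_vol (real (DIM('a) - i)) * V i)
      - (\<Sum>i\<le>DIM('a). t ^ (DIM('a) - i) * unit_ball_vol (real (DIM('a) - i)) * W i)"
      unfolding sum_subtractf[symmetric] by (intro sum.cong) (auto simp: c_def algebra_simps)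
    also have "\<dots> = 0"
      using V W that unfolding steiner_formula_def by simp
    finally show ?thesis .
  qed
  then have "{0..1} \<subseteq> {t. (\<Sum>i\<le>DIM('a). c i * t ^ i) = 0}"
    by auto
  then have "infinite {t. (\<Sum>i\<le>DIM('a). c i * t ^ i) = 0}"
    using infinite_Icc[of "0::real" 1] by (meson finite_subset zero_less_one)
  then have "c (DIM('a) - j) = 0"
    using polyfun_finite_roots[of c "DIM('a)"] by auto
  then show ?thesis
    using j unit_ball_vol_pos[of "real (DIM('a) - j)"] by (auto simp: c_def simp del: unit_ball_vol_pos of_nat_diff)
qed

lemma intrinsic_volume_eqI:
  fixes K :: "'a::euclidean_space set"
  assumes V: "steiner_formula K V" and j: "j \<le> DIM('a)"
  shows "intrinsic_volume K j = V j"
proof -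
  define W where "W i = (if i \<le> DIM('a) then V i else 0)" for i
  have W: "steiner_formula K W"
    using V by (simp add: steiner_formula_def W_def)
  have "intrinsic_volume K = W"
    unfolding intrinsic_volume_def
  proof (rule the_equality)
    fix U assume "steiner_formula K U \<and> (\<forall>j>DIM('a). U j = 0)"
    then show "U = W"
      using steiner_formula_unique[OF _ W, of U] by (force simp: W_def not_le)
  qed (use W in \<open>auto simp: W_def\<close>)
  with j show ?thesis by (simp add: W_def)
qed

end

theory Submission
  imports Defs
begin

text \<open>For a convex body \<open>P\<close> the volume of \<open>P + s [0,x]\<close> is affine in \<open>s \<ge> 0\<close>, so the volume of
  \<open>P + \<Sum>i\<in>I. [0,x\<^sub>i]\<close> is the sum over \<open>S \<subseteq> I\<close> of the mixed differences of the volume at \<open>P\<close> along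
  \<open>x\<^sub>i\<close>, \<open>i \<in> S\<close>. Such a difference depends on \<open>P\<close> only modulo the span of these \<open>x\<^sub>i\<close>. For a ball it
  may therefore be evaluated at the section of the ball orthogonal to them; there it is the
  volume of a linear image of a cylinder, which is the root of the Gram determinant times the volume of
  a lower-dimensional ball. This is the Steiner formula of a zonotope, that is, the theorem for a
  distribution with finite support, where the sum over \<open>k\<close>-subsets is an expectation over \<open>k\<close>
  independent copies, divided by \<open>k!\<close>. In general \<open>\<xi>\<close> is approximated in \<open>L\<^sup>1\<close> by simple functions of \<open>\<xi>\<close>: if
  \<open>\<epsilon>\<close> is the \<open>L\<^sup>1\<close>-error, the bodies are contained in each other's \<open>\<epsilon>\<close>-neighbourhoods, so the volumes
  of the parallel bodies are squeezed between Steiner polynomials that converge.\<close>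

subsection \<open>Minkowski sums with segments\<close>

text \<open>Affinity in \<open>s\<close> stands in for the theory of mixed volumes: neither
  polynomiality of the volume for sums of general bodies nor its Hausdorff continuity is used. The
  obstacle is the ball: its sum with segments is no linear image of a cylinder, and it may be cut
  down to a section only after all the segments of \<open>S\<close> have been differenced out.
  Monotonicity makes this legal. Differences along segments preserve monotone, translation
  invariant, segment-affine functionals, and for such a functional the directions that do not matter
  form a subspace. Positivity also isolates the top term at the section: the section plus a proper
  subfamily of the segments is too flat to have volume. The factor \<open>1/k!\<close> arises
  because a \<open>k\<close>-subset comes from \<open>k!\<close> ordered samples, while samples with
  a repetition have Gram determinant 0. A first moment suffices for every \<open>k\<close> because a
  product of independent integrable norms is integrable. The squeeze uses radii
  \<open>t - \<epsilon>\<close>, which forces \<open>t > 0\<close>; the value at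
  \<open>t = 0\<close> is recovered by a decreasing limit.\<close>

abbreviation (input) seg :: "'a::real_vector \<Rightarrow> 'a set" where
  "seg x \<equiv> closed_segment 0 x"

lemma in_set_plus_seg_iff: "z \<in> P + seg x \<longleftrightarrow> (\<exists>p\<in>P. \<exists>u. 0 \<le> u \<and> u \<le> 1 \<and> z = p + u *\<^sub>R x)"
  by (auto simp: set_plus_def closed_segment_def)

text \<open>With the parameter in \<open>[0, s]\<close> instead of \<open>[0, 1]\<close>, segments
  of different lengths in one direction are compared by arithmetic on the parameter alone.\<close>

lemma in_set_plus_seg_scaleR_iff:
  assumes "0 \<le> s"
  shows "z \<in> P + seg (s *\<^sub>R x) \<longleftrightarrow> (\<exists>p\<in>P. \<exists>u. 0 \<le> u \<and> u \<le> s \<and> z = p + u *\<^sub>R x)"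
proof -
  have 1: "\<exists>v. 0 \<le> v \<and> v \<le> s \<and> u *\<^sub>R s *\<^sub>R x = v *\<^sub>R x" if "0 \<le> u" "u \<le> 1" for u
    using that assms by (intro exI[of _ "u * s"]) (auto simp: mult_left_le_one_le)
  have 2: "\<exists>u. 0 \<le> u \<and> u \<le> 1 \<and> v *\<^sub>R x = u *\<^sub>R s *\<^sub>R x" if "0 \<le> v" "v \<le> s" for v
    using that assms by (cases "s = 0") (auto intro!: exI[of _ "v / s"] simp: field_simps)
  show ?thesis unfolding in_set_plus_seg_iff using 1 2 by metis
qed

lemma convex_body_set_plus:
  assumes "convex_body P" "convex_body Q"
  shows "convex_body (P + Q)"
proof -
  have "P + Q = (\<lambda>z. fst z + snd z) ` (P \<times> Q)"
    by (simp add: set_plus_image case_prod_beta')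
  moreover have "compact ((\<lambda>z. fst z + snd z) ` (P \<times> Q))"
    using assms by (intro compact_continuous_image continuous_intros compact_Times)
      (auto simp: convex_body_def)
  ultimately have "compact (P + Q)"
    by simp
  then show ?thesis
    using assms set_plus_intro by (fastforce simp: convex_body_def intro: convex_set_plus)
qed

lemma convex_body_seg [simp]: "convex_body (seg x)"
  by (auto simp: convex_body_def)

lemma convex_body_singleton [simp]: "convex_body {a}"
  by (auto simp: convex_body_def)

lemma convex_body_cball [simp]: "0 \<le> r \<Longrightarrow> convex_body (cball a r)"
  by (auto simp: convex_body_def)

lemma convex_body_sum:
  assumes "\<And>i. i \<in> S \<Longrightarrow> convex_body (P i)"
  shows "convex_body (\<Sum>i\<in>S. P i)"
  using assms
proof (induction S rule: infinite_finite_induct)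
  case (insert i S)
  then show ?case by (auto intro!: convex_body_set_plus)
qed (auto simp: set_zero)

lemma subset_set_plus_left:
  fixes P Q :: "'a::comm_monoid_add set"
  assumes "0 \<in> Q"
  shows "P \<subseteq> P + Q"
  using assms set_zero_plus2[of Q P] by (simp add: add.commute)

lemma convex_body_lmeasurable: "convex_body P \<Longrightarrow> P \<in> lmeasurable"
  by (auto simp: convex_body_def lmeasurable_compact)

lemma singleton_plus_image: "{a} + P = (+) a ` P"
  by (auto simp: set_plus_def)

lemma in_singleton_plus_iff: "z \<in> {a} + P \<longleftrightarrow> (\<exists>p\<in>P. z = a + p)"
  by (auto simp: set_plus_def)

text \<open>A nonempty section of \<open>P\<close> parallel to \<open>x\<close> is an interval, and adding \<open>seg (s *\<^sub>R x)\<close> moves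
  its right endpoint by \<open>s\<close>. The bodies \<open>P + seg (s *\<^sub>R x)\<close> and \<open>P + seg (r *\<^sub>R x) + s *\<^sub>R x\<close> thus
  overlap exactly in \<open>P + s *\<^sub>R x\<close>.\<close>

lemma measure_set_plus_seg_add:
  fixes P :: "'a::euclidean_space set"
  assumes P: "convex_body P" and s: "0 \<le> s" and r: "0 \<le> r"
  shows "measure lebesgue (P + seg ((s + r) *\<^sub>R x)) + measure lebesgue P =
    measure lebesgue (P + seg (s *\<^sub>R x)) + measure lebesgue (P + seg (r *\<^sub>R x))"
proof -
  let ?A = "P + seg (s *\<^sub>R x)" and ?B = "{s *\<^sub>R x} + (P + seg (r *\<^sub>R x))"
  have sr: "0 \<le> s + r" using s r by simp
  have union: "P + seg ((s + r) *\<^sub>R x) = ?A \<union> ?B"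
  proof (intro subset_antisym subsetI)
    fix z assume "z \<in> P + seg ((s + r) *\<^sub>R x)"
    then obtain p u where pu: "p \<in> P" "0 \<le> u" "u \<le> s + r" "z = p + u *\<^sub>R x"
      unfolding in_set_plus_seg_scaleR_iff[OF sr] by blast
    show "z \<in> ?A \<union> ?B"
    proof (cases "u \<le> s")
      case True
      then show ?thesis using pu by (auto simp: in_set_plus_seg_scaleR_iff[OF s])
    next
      case False
      have "z = s *\<^sub>R x + (p + (u - s) *\<^sub>R x)"
        using pu by (simp add: algebra_simps)
      moreover have "p + (u - s) *\<^sub>R x \<in> P + seg (r *\<^sub>R x)"
        using pu False by (auto simp: in_set_plus_seg_scaleR_iff[OF r] intro!: bexI[of _ p] exI[of _ "u - s"])
      ultimately show ?thesis by auto
    qed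
  next
    fix z assume "z \<in> ?A \<union> ?B"
    then consider "z \<in> ?A" | w where "z = s *\<^sub>R x + w" "w \<in> P + seg (r *\<^sub>R x)"
      unfolding Un_iff in_singleton_plus_iff by blast
    then show "z \<in> P + seg ((s + r) *\<^sub>R x)"
    proof cases
      case 1
      then obtain p u where "p \<in> P" "0 \<le> u" "u \<le> s" "z = p + u *\<^sub>R x"
        unfolding in_set_plus_seg_scaleR_iff[OF s] by blast
      then show ?thesis using r
        unfolding in_set_plus_seg_scaleR_iff[OF sr] by (intro bexI[of _ p] exI[of _ u]) auto
    next
      case 2
      then obtain p u where "p \<in> P" "0 \<le> u" "u \<le> r" "z = s *\<^sub>R x + (p + u *\<^sub>R x)"
        unfolding in_set_plus_seg_scaleR_iff[OF r] by blast
      then show ?thesis using s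
        unfolding in_set_plus_seg_scaleR_iff[OF sr]
        by (intro bexI[of _ p] exI[of _ "s + u"]) (auto simp: algebra_simps)
    qed
  qed
  have inter: "?A \<inter> ?B = {s *\<^sub>R x} + P"
  proof (intro subset_antisym subsetI)
    fix z assume z: "z \<in> ?A \<inter> ?B"
    then obtain p u where pu: "p \<in> P" "0 \<le> u" "u \<le> s" "z = p + u *\<^sub>R x"
      unfolding Int_iff in_set_plus_seg_scaleR_iff[OF s] by blast
    from z obtain w where w: "z = s *\<^sub>R x + w" "w \<in> P + seg (r *\<^sub>R x)"
      unfolding Int_iff in_singleton_plus_iff by blast
    then obtain q v where qv: "q \<in> P" "0 \<le> v" "v \<le> r" "w = q + v *\<^sub>R x"
      unfolding in_set_plus_seg_scaleR_iff[OF r] by blast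
    \<comment> \<open>The point \<open>w\<close> equals both \<open>p - y *\<^sub>R x\<close> and
      \<open>q + v *\<^sub>R x\<close> with \<open>y\<close> and \<open>v\<close> nonnegative, so it
      lies between \<open>p\<close> and \<open>q\<close> on a line parallel to \<open>x\<close>.
      Convexity applies with weights proportional to \<open>v\<close> and \<open>y\<close>.\<close>
    define y where "y = s - u"
    have wp: "w = p - y *\<^sub>R x"
      using w pu by (simp add: y_def algebra_simps)
    have "w \<in> P"
    proof (cases "v + y = 0")
      case True
      then have "v = 0" using qv pu by (auto simp: y_def)
      then show ?thesis using qv by simp
    next
      case False
      then have pos: "v + y > 0" using qv pu by (auto simp: y_def)
      have "(v + y) *\<^sub>R w = v *\<^sub>R (p - y *\<^sub>R x) + y *\<^sub>R (q + v *\<^sub>R x)"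
        using wp qv by (simp add: scaleR_add_left)
      also have "\<dots> = v *\<^sub>R p + y *\<^sub>R q"
        by (simp add: algebra_simps)
      finally have "w = (v / (v + y)) *\<^sub>R p + (y / (v + y)) *\<^sub>R q"
        using pos by (metis (no_types, lifting) divide_inverse_commute less_irrefl
            scaleR_add_right scaleR_scaleR inverse_eq_divide divideR_right)
      moreover have "convex P" using P by (auto simp: convex_body_def)
      ultimately show ?thesis
        using convexD[OF _ pu(1) qv(1), of "v / (v + y)" "y / (v + y)"] pos qv pu
        by (auto simp: y_def add_divide_distrib[symmetric])
    qed
    then show "z \<in> {s *\<^sub>R x} + P" using w by auto
  next
    fix z assume "z \<in> {s *\<^sub>R x} + P"
    then obtain p where p: "p \<in> P" "z = s *\<^sub>R x + p" by (auto simp: set_plus_def)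
    have "z \<in> ?A" using p s
      unfolding in_set_plus_seg_scaleR_iff[OF s] by (intro bexI[of _ p] exI[of _ s]) auto
    moreover have "p \<in> P + seg (r *\<^sub>R x)" using p r
      unfolding in_set_plus_seg_scaleR_iff[OF r] by (intro bexI[of _ p] exI[of _ 0]) auto
    then have "z \<in> ?B" using p by auto
    ultimately show "z \<in> ?A \<inter> ?B" by simp
  qed
  have A: "?A \<in> lmeasurable" and B: "?B \<in> lmeasurable"
    using P by (auto intro!: convex_body_lmeasurable convex_body_set_plus)
  have "measure lebesgue (?A \<union> ?B) + measure lebesgue (?A \<inter> ?B) =
      measure lebesgue ?A + measure lebesgue ?B"
    using measure_Un3[OF A B] by simp
  then show ?thesis
    unfolding union inter by (simp add: singleton_plus_image measure_translation)
qed

text \<open>Cauchy's functional equation on the half-line. Nonnegative increments make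
  \<open>h\<close> monotone; squeezing \<open>n * s\<close> between consecutive integers bounds the
  deviation from linearity at \<open>s\<close> by \<open>h 1 / n\<close> for every
  \<open>n\<close>.\<close>

lemma nonneg_additive_imp_linear:
  fixes h :: "real \<Rightarrow> real"
  assumes add: "\<And>s r. 0 \<le> s \<Longrightarrow> 0 \<le> r \<Longrightarrow> h (s + r) = h s + h r"
    and nonneg: "\<And>s. 0 \<le> s \<Longrightarrow> 0 \<le> h s" and s: "0 \<le> s"
  shows "h s = s * h 1"
proof -
  have mono: "h s \<le> h r" if "0 \<le> s" "s \<le> r" for s r
    using add[of s "r - s"] nonneg[of "r - s"] that by simp
  have mult: "h (real n * s) = real n * h s" if "0 \<le> s" for n s
  proof (induction n)
    case 0
    show ?case using add[of 0 0] by simp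
  next
    case (Suc n)
    then show ?case using add[of s "real n * s"] that by (simp add: algebra_simps)
  qed
  have bound: "\<bar>h s - s * h 1\<bar> * real n \<le> h 1" for n
  proof -
    define m where "m = nat \<lfloor>real n * s\<rfloor>"
    have m: "real m \<le> real n * s" "real n * s \<le> real (Suc m)"
      using s by (auto simp: m_def of_nat_nat) linarith
    have 1: "real m * h 1 \<le> real n * h s"
      using mono[of "real m" "real n * s"] m mult[of 1 m] mult[OF s, of n] by simp
    have 2: "real n * h s \<le> real (Suc m) * h 1"
      using mono[of "real n * s" "real (Suc m)"] m mult[of 1 "Suc m"] mult[OF s, of n] s by simp
    have 3: "real m * h 1 \<le> real n * s * h 1" "real n * s * h 1 \<le> real (Suc m) * h 1"
      using m nonneg[of 1] by (auto intro!: mult_right_mono simp del: of_nat_Suc)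
    have "\<bar>h s - s * h 1\<bar> * real n = \<bar>real n * h s - real n * s * h 1\<bar>"
      using abs_mult[of "h s - s * h 1" "real n"] by (simp add: algebra_simps)
    also have "\<dots> \<le> h 1"
      using 1 2 3 by (auto simp: abs_if algebra_simps)
    finally show ?thesis .
  qed
  show ?thesis
  proof (rule ccontr)
    assume "h s \<noteq> s * h 1"
    then have pos: "\<bar>h s - s * h 1\<bar> > 0" by simp
    then obtain n where "real n * \<bar>h s - s * h 1\<bar> > h 1"
      using reals_Archimedean3 by blast
    with bound[of n] show False by (simp add: mult.commute)
  qed
qed

lemma measure_mono_convex_body:
  assumes "convex_body P" "convex_body Q" "P \<subseteq> Q"
  shows "measure lebesgue P \<le> measure lebesgue Q"
  using assms by (intro measure_mono_fmeasurable)
    (auto intro: convex_body_lmeasurable fmeasurableD)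

lemma measure_set_plus_seg_affine:
  fixes P :: "'a::euclidean_space set"
  assumes P: "convex_body P" and s: "0 \<le> s"
  shows "measure lebesgue (P + seg (s *\<^sub>R x)) =
    measure lebesgue P + s * (measure lebesgue (P + seg x) - measure lebesgue P)"
proof -
  define h where "h s = measure lebesgue (P + seg (s *\<^sub>R x)) - measure lebesgue P" for s
  have "h (s + r) = h s + h r" if "0 \<le> s" "0 \<le> r" for s r
    using measure_set_plus_seg_add[OF P that, of x] by (simp add: h_def)
  moreover have "h s \<ge> 0" for s
    unfolding h_def using P
    by (auto intro!: measure_mono_convex_body convex_body_set_plus subset_set_plus_left)
  ultimately have "h s = s * h 1"
    using nonneg_additive_imp_linear[of h s] s by simp
  then show ?thesis by (simp add: h_def algebra_simps)
qed

subsection \<open>Difference operators along segments\<close>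

text \<open>The properties of the volume that survive taking differences, so that iterated
  differences stay in the class. They are demanded at convex bodies only, although \<open>F\<close>
  is defined on all sets.\<close>

definition seg_affine :: "('a::euclidean_space set \<Rightarrow> real) \<Rightarrow> bool" where
  "seg_affine F \<longleftrightarrow>
     (\<forall>P Q. convex_body P \<longrightarrow> convex_body Q \<longrightarrow> P \<subseteq> Q \<longrightarrow> F P \<le> F Q) \<and>
     (\<forall>P a. convex_body P \<longrightarrow> F ({a} + P) = F P) \<and>
     (\<forall>P x s. convex_body P \<longrightarrow> 0 \<le> s \<longrightarrow>
        F (P + seg (s *\<^sub>R x)) = F P + s * (F (P + seg x) - F P))"

definition seg_diff :: "'a::euclidean_space \<Rightarrow> ('a set \<Rightarrow> real) \<Rightarrow> 'a set \<Rightarrow> real" where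
  "seg_diff x F P = F (P + seg x) - F P"

text \<open>The operators commute, so the fold does not depend on an order; indexing by
  \<open>S\<close> lets a vector occur repeatedly. For the volume in dimension \<open>d\<close> and
  finite \<open>S\<close> of size \<open>k \<le> d\<close>, the value at a convex body
  \<open>P\<close> is \<open>d! / (d - k)!\<close> times the mixed volume of \<open>d - k\<close>
  copies of \<open>P\<close> and the \<open>k\<close> segments.\<close>

definition mixed_diff :: "'i set \<Rightarrow> ('i \<Rightarrow> 'a::euclidean_space) \<Rightarrow> ('a set \<Rightarrow> real) \<Rightarrow> 'a set \<Rightarrow> real" where
  "mixed_diff S x F = Finite_Set.fold (\<lambda>i. seg_diff (x i)) F S"

lemma seg_affine_mono:
  "seg_affine F \<Longrightarrow> convex_body P \<Longrightarrow> convex_body Q \<Longrightarrow> P \<subseteq> Q \<Longrightarrow> F P \<le> F Q"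
  by (simp add: seg_affine_def)

lemma seg_affine_translation: "seg_affine F \<Longrightarrow> convex_body P \<Longrightarrow> F ({a} + P) = F P"
  by (simp add: seg_affine_def)

lemma seg_affine_scaleR:
  "seg_affine F \<Longrightarrow> convex_body P \<Longrightarrow> 0 \<le> s \<Longrightarrow>
    F (P + seg (s *\<^sub>R x)) = F P + s * (F (P + seg x) - F P)"
  by (simp add: seg_affine_def)

lemma seg_affine_measure: "seg_affine (measure lebesgue)"
  unfolding seg_affine_def
  by (auto simp: measure_set_plus_seg_affine singleton_plus_image measure_translation
      intro: measure_mono_convex_body)

lemma slope_le_of_affine_le:
  fixes a b c d :: real
  assumes "\<And>s. 0 \<le> s \<Longrightarrow> a + s * b \<le> c + s * d"
  shows "b \<le> d"
proof (rule ccontr)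
  assume "\<not> b \<le> d"
  then obtain n where n: "c - a < real n * (b - d)"
    using reals_Archimedean3[of "b - d"] by auto
  have "real n * (b - d) \<le> c - a"
    using assms[of "real n"] by (simp add: algebra_simps)
  with n show False by simp
qed

text \<open>A slope inherits monotonicity: compare \<open>F (P + seg (s *\<^sub>R x))\<close> and \<open>F (Q + seg (s *\<^sub>R x))\<close> as
  \<open>s\<close> grows.\<close>

lemma seg_affine_seg_diff:
  assumes F: "seg_affine F"
  shows "seg_affine (seg_diff x F)"
  unfolding seg_affine_def
proof (intro conjI allI impI)
  fix P Q :: "'a set" assume PQ: "convex_body P" "convex_body Q" "P \<subseteq> Q"
  show "seg_diff x F P \<le> seg_diff x F Q"
  proof (rule slope_le_of_affine_le)
    fix s :: real assume "0 \<le> s"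
    then have "F (P + seg (s *\<^sub>R x)) \<le> F (Q + seg (s *\<^sub>R x))"
      using PQ by (intro seg_affine_mono[OF F] convex_body_set_plus set_plus_mono2) auto
    then show "F P + s * seg_diff x F P \<le> F Q + s * seg_diff x F Q"
      using PQ \<open>0 \<le> s\<close> by (simp add: seg_affine_scaleR[OF F] seg_diff_def)
  qed
next
  fix P :: "'a set" and a assume P: "convex_body P"
  then show "seg_diff x F ({a} + P) = seg_diff x F P"
    by (simp add: seg_diff_def seg_affine_translation[OF F] convex_body_set_plus add.assoc)
next
  fix P :: "'a set" and y and s :: real assume P: "convex_body P" and s: "0 \<le> s"
  have swap: "P + seg (s *\<^sub>R y) + seg x = P + seg x + seg (s *\<^sub>R y)"
    "P + seg y + seg x = P + seg x + seg y"
    by (simp_all add: ac_simps)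
  show "seg_diff x F (P + seg (s *\<^sub>R y)) =
      seg_diff x F P + s * (seg_diff x F (P + seg y) - seg_diff x F P)"
    unfolding seg_diff_def swap
    using seg_affine_scaleR[OF F P s, of y] seg_affine_scaleR[OF F convex_body_set_plus[OF P convex_body_seg] s, of x y]
    by (simp add: algebra_simps del: add.assoc)
qed

interpretation seg_diff: comp_fun_commute "\<lambda>i. seg_diff (x i)" for x :: "'i \<Rightarrow> 'a::euclidean_space"
  by unfold_locales (auto simp: fun_eq_iff seg_diff_def ac_simps)

lemma mixed_diff_empty [simp]: "mixed_diff {} x F = F"
  by (simp add: mixed_diff_def)

lemma mixed_diff_insert:
  "finite S \<Longrightarrow> i \<notin> S \<Longrightarrow> mixed_diff (insert i S) x F = seg_diff (x i) (mixed_diff S x F)"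
  by (simp add: mixed_diff_def)

lemma seg_affine_mixed_diff: "finite S \<Longrightarrow> seg_affine F \<Longrightarrow> seg_affine (mixed_diff S x F)"
  by (induction S rule: finite_induct) (auto simp: mixed_diff_insert seg_affine_seg_diff)

lemma mixed_diff_nonneg:
  assumes "finite S" "seg_affine F" "\<And>P. convex_body P \<Longrightarrow> 0 \<le> F P" "convex_body P"
  shows "0 \<le> mixed_diff S x F P"
  using assms(1)
proof (induction S rule: finite_induct)
  case (insert i S)
  then show ?case using assms(2,4)
    by (auto simp: mixed_diff_insert seg_diff_def
        intro!: seg_affine_mono[OF seg_affine_mixed_diff] convex_body_set_plus subset_set_plus_left)
qed (use assms in auto)

text \<open>Adding \<open>seg (x i)\<close> to the argument acts as the identity plus
  \<open>seg_diff (x i)\<close>; the right-hand side is the product of these commuting operators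
  multiplied out.\<close>

lemma mixed_diff_expansion:
  assumes "finite I"
  shows "F (P + (\<Sum>i\<in>I. seg (x i))) = (\<Sum>S\<in>Pow I. mixed_diff S x F P)"
  using assms
proof (induction I arbitrary: P rule: finite_induct)
  case empty
  show ?case by (simp add: set_zero)
next
  case (insert i I)
  have "F (P + (\<Sum>i\<in>insert i I. seg (x i))) = F ((P + seg (x i)) + (\<Sum>i\<in>I. seg (x i)))"
    using insert.hyps by (simp add: add.assoc)
  also have "\<dots> = (\<Sum>S\<in>Pow I. mixed_diff S x F (P + seg (x i)))"
    by (rule insert.IH)
  also have "\<dots> = (\<Sum>S\<in>Pow I. mixed_diff S x F P) + (\<Sum>S\<in>Pow I. mixed_diff (insert i S) x F P)"
    unfolding sum.distrib[symmetric]
  proof (rule sum.cong[OF refl])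
    fix S assume "S \<in> Pow I"
    then have "finite S" "i \<notin> S" using insert.hyps finite_subset by auto
    then show "mixed_diff S x F (P + seg (x i)) = mixed_diff S x F P + mixed_diff (insert i S) x F P"
      by (simp add: mixed_diff_insert seg_diff_def)
  qed
  also have "(\<Sum>S\<in>Pow I. mixed_diff (insert i S) x F P) = (\<Sum>S\<in>insert i ` Pow I. mixed_diff S x F P)"
    using insert.hyps by (subst sum.reindex) (auto simp: inj_on_def)
  also have "(\<Sum>S\<in>Pow I. mixed_diff S x F P) + \<dots> = (\<Sum>S\<in>Pow (insert i I). mixed_diff S x F P)"
    unfolding Pow_insert using insert.hyps
    by (intro sum.union_disjoint[symmetric]) auto
  finally show ?case .
qed

section \<open>Directions along which a functional is constant\<close>

definition null_directions :: "('a::euclidean_space set \<Rightarrow> real) \<Rightarrow> 'a set" where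
  "null_directions F = {y. \<forall>P. convex_body P \<longrightarrow> F (P + seg y) = F P}"

text \<open>Each property of \<open>seg_affine\<close> pays for one closure property: affinity for
  nonnegative multiples, translation invariance for negatives, as \<open>seg (- y)\<close> is a
  translate of \<open>seg y\<close>, and monotonicity for sums, as the diagonal
  \<open>seg (y + z)\<close> lies in the parallelogram \<open>seg y + seg z\<close>.\<close>

lemma subspace_null_directions:
  assumes F: "seg_affine F"
  shows "subspace (null_directions F)"
proof -
  have pos: "s *\<^sub>R y \<in> null_directions F" if "y \<in> null_directions F" "0 \<le> s" for s y
    using that by (auto simp: null_directions_def seg_affine_scaleR[OF F])
  have neg: "- y \<in> null_directions F" if y: "y \<in> null_directions F" for y
  proof -
    have eq: "P + seg (- y) = {- y} + (P + seg y)" for P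
    proof -
      have "seg (- y) = {- y} + seg y"
        using closed_segment_translation[of "-y" 0 y] closed_segment_commute
        by (metis add.right_inverse add.commute add.right_neutral singleton_plus_image)
      then show ?thesis by (simp add: ac_simps)
    qed
    show ?thesis unfolding null_directions_def
    proof safe
      fix P :: "'a set" assume P: "convex_body P"
      have "F (P + seg (- y)) = F (P + seg y)"
        unfolding eq using P by (intro seg_affine_translation[OF F] convex_body_set_plus) auto
      then show "F (P + seg (- y)) = F P" using y P by (simp add: null_directions_def)
    qed
  qed
  show ?thesis unfolding subspace_def
  proof (intro conjI ballI allI)
    show "0 \<in> null_directions F" by (simp add: null_directions_def flip: set_zero)
  next
    fix y z assume y: "y \<in> null_directions F" and z: "z \<in> null_directions F"
    show "y + z \<in> null_directions F"
      unfolding null_directions_def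
    proof safe
      fix P :: "'a set" assume P: "convex_body P"
      have "seg (y + z) \<subseteq> seg y + seg z"
      proof
        fix v assume "v \<in> seg (y + z)"
        then obtain u where u: "0 \<le> u" "u \<le> 1" "v = u *\<^sub>R y + u *\<^sub>R z"
          by (auto simp: closed_segment_def algebra_simps)
        moreover have "u *\<^sub>R y \<in> seg y" "u *\<^sub>R z \<in> seg z"
          using u by (auto simp: closed_segment_def)
        ultimately show "v \<in> seg y + seg z" by auto
      qed
      then have "F (P + seg (y + z)) \<le> F (P + seg y + seg z)"
        using P unfolding add.assoc
        by (intro seg_affine_mono[OF F] convex_body_set_plus set_plus_mono2) auto
      also have "\<dots> = F P"
        using y z P by (simp add: null_directions_def convex_body_set_plus)
      finally have "F (P + seg (y + z)) \<le> F P" .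
      moreover have "F P \<le> F (P + seg (y + z))"
        using P by (intro seg_affine_mono[OF F] convex_body_set_plus subset_set_plus_left) auto
      ultimately show "F (P + seg (y + z)) = F P" by simp
    qed
  next
    fix c y assume y: "y \<in> null_directions F"
    show "c *\<^sub>R y \<in> null_directions F"
    proof (cases "0 \<le> c")
      case True
      then show ?thesis using pos y by blast
    next
      case False
      then show ?thesis using pos[OF neg[OF y], of "- c"] by simp
    qed
  qed
qed

lemma null_directions_sum:
  assumes "finite B" "\<And>b. b \<in> B \<Longrightarrow> g b \<in> null_directions F" "convex_body P"
  shows "F (P + (\<Sum>b\<in>B. seg (g b))) = F P"
  using assms
proof (induction B arbitrary: P rule: finite_induct)
  case empty
  then show ?case by (simp add: set_zero)
next
  case (insert b B)
  have "F (P + (\<Sum>b\<in>insert b B. seg (g b))) = F ((P + seg (g b)) + (\<Sum>b\<in>B. seg (g b)))"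
    using insert.hyps by (simp add: add.assoc)
  also have "\<dots> = F (P + seg (g b))"
    using insert.prems by (intro insert.IH convex_body_set_plus) auto
  also have "\<dots> = F P"
    using insert.prems by (auto simp: null_directions_def)
  finally show ?case .
qed

text \<open>\<open>seg x + seg x = seg (2 *\<^sub>R x)\<close>, so a functional affine along \<open>x\<close> has a constant difference
  along \<open>x\<close>.\<close>

lemma null_directions_mixed_diff:
  assumes F: "seg_affine F" and S: "finite S" and i: "i \<in> S"
  shows "x i \<in> null_directions (mixed_diff S x F)"
proof -
  define G where "G = mixed_diff (S - {i}) x F"
  have G: "seg_affine G" using F S by (simp add: G_def seg_affine_mixed_diff)
  have eq: "mixed_diff S x F = seg_diff (x i) G"
    using mixed_diff_insert[of "S - {i}" i x F] S i by (simp add: G_def insert_absorb)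
  have double: "seg (x i) + seg (x i) = seg (2 *\<^sub>R x i)"
  proof -
    have "seg (x i) + seg (x i) = (\<lambda>v. 2 *\<^sub>R v) ` seg (x i)"
    proof (intro subset_antisym subsetI)
      fix v assume "v \<in> seg (x i) + seg (x i)"
      then obtain a b where ab: "a \<in> seg (x i)" "b \<in> seg (x i)" "v = a + b"
        by (auto elim: set_plus_elim)
      have "(1/2) *\<^sub>R a + (1/2) *\<^sub>R b \<in> seg (x i)"
        using ab by (intro convexD[OF convex_closed_segment]) auto
      then show "v \<in> (\<lambda>v. 2 *\<^sub>R v) ` seg (x i)"
        using ab by (intro image_eqI[of _ _ "(1/2) *\<^sub>R a + (1/2) *\<^sub>R b"]) (auto simp: scaleR_add_right)
    qed (auto simp: scaleR_2)
    also have "\<dots> = seg (2 *\<^sub>R x i)"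
      using closed_segment_linear_image[of "\<lambda>v. 2 *\<^sub>R v" 0 "x i"]
      by (simp add: linear_scaleR)
    finally show ?thesis .
  qed
  show ?thesis
    unfolding null_directions_def eq seg_diff_def
    by (auto simp: add.assoc double seg_affine_scaleR[OF G])
qed

text \<open>The difference along the other indices is constant along the span of their vectors,
  which contains \<open>x i\<close>, so one more difference along \<open>x i\<close> gives
  0.\<close>

lemma mixed_diff_eq_0_dependent:
  assumes F: "seg_affine F" and S: "finite S" and i: "i \<in> S" "x i \<in> span (x ` (S - {i}))"
    and P: "convex_body P"
  shows "mixed_diff S x F P = 0"
proof -
  define G where "G = mixed_diff (S - {i}) x F"
  have "x ` (S - {i}) \<subseteq> null_directions G"
    using null_directions_mixed_diff[OF F, of "S - {i}"] S by (auto simp: G_def)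
  then have "span (x ` (S - {i})) \<subseteq> null_directions G"
    using F S by (intro span_minimal subspace_null_directions) (auto simp: G_def seg_affine_mixed_diff)
  then have "x i \<in> null_directions G" using i by auto
  moreover have "mixed_diff S x F = seg_diff (x i) G"
    using mixed_diff_insert[of "S - {i}" i x F] S i by (simp add: G_def insert_absorb)
  ultimately show ?thesis using P by (simp add: seg_diff_def null_directions_def)
qed

section \<open>Replacing the ball by a section\<close>

lemma convex_body_cball_Int_orthogonal:
  assumes "0 \<le> t"
  shows "convex_body (cball 0 t \<inter> {v. \<forall>i\<in>S. v \<bullet> x i = 0})"
proof -
  have "{v. \<forall>i\<in>S. v \<bullet> x i = 0} = (\<Inter>i\<in>S. {v. x i \<bullet> v = 0})" by (auto simp: inner_commute)
  then have "closed {v. \<forall>i\<in>S. v \<bullet> x i = 0}" "convex {v. \<forall>i\<in>S. v \<bullet> x i = 0}"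
    by (auto intro!: closed_INT closed_hyperplane convex_INT convex_hyperplane)
  moreover have "0 \<in> cball 0 t \<inter> {v. \<forall>i\<in>S. v \<bullet> x i = 0}" using assms by simp
  ultimately show ?thesis
    unfolding convex_body_def by (blast intro: compact_Int_closed convex_Int compact_cball convex_cball)
qed

text \<open>The ball lies between its section orthogonal to the \<open>x i\<close> and a translate
  of this section plus a cube in their span. The edges of the cube are null directions of the mixed
  difference, so by monotonicity all three values agree.\<close>

lemma mixed_diff_cball:
  fixes x :: "'i \<Rightarrow> 'a::euclidean_space"
  assumes F: "seg_affine F" and S: "finite S" and t: "0 \<le> t"
  shows "mixed_diff S x F (cball 0 t) = mixed_diff S x F (cball 0 t \<inter> {v. \<forall>i\<in>S. v \<bullet> x i = 0})"
proof -
  define G where "G = mixed_diff S x F"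
  have G: "seg_affine G" using F S by (simp add: G_def seg_affine_mixed_diff)
  define W where "W = {v. \<forall>i\<in>S. v \<bullet> x i = 0}"
  have body: "convex_body (cball 0 t \<inter> W)"
    unfolding W_def using t by (rule convex_body_cball_Int_orthogonal)
  obtain B where B: "pairwise orthogonal B" "\<And>b. b \<in> B \<Longrightarrow> norm b = 1" "independent B"
      "span B = span (x ` S)"
    using orthonormal_basis_subspace[of "span (x ` S)"] by (metis subspace_span)
  have "finite B" using B(3) by (rule independent_imp_finite)
  have "x ` S \<subseteq> null_directions G"
    using null_directions_mixed_diff[OF F S] by (auto simp: G_def)
  then have "span B \<subseteq> null_directions G"
    unfolding B(4) by (intro span_minimal subspace_null_directions G)
  then have null: "(2 * t) *\<^sub>R b \<in> null_directions G" if "b \<in> B" for b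
    using that span_scale[OF span_base] by blast
  \<comment> \<open>In an orthonormal basis of the span, the coordinates of points of the ball lie
    in \<open>[-t, t]\<close>. The cube with these sides is written as the sum \<open>Z\<close> of
    segments of length \<open>2 * t\<close> starting at 0, shifted by \<open>c\<close>.\<close>
  define c where "c = - (\<Sum>b\<in>B. t *\<^sub>R b)"
  define Z where "Z = (\<Sum>b\<in>B. seg ((2 * t) *\<^sub>R b))"
  have Z: "convex_body Z" by (auto simp: Z_def intro: convex_body_sum)
  have sub: "cball 0 t \<subseteq> {c} + (cball 0 t \<inter> W + Z)"
  proof
    fix p :: 'a assume "p \<in> cball 0 t"
    then have p: "norm p \<le> t" by simp
    define q where "q = (\<Sum>b\<in>B. (b \<bullet> p) *\<^sub>R b)"
    have bb: "b \<bullet> b = 1" if "b \<in> B" for b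
      using B(2)[OF that] by (simp add: norm_eq_1)
    have orth: "orthogonal v (p - q)" if "v \<in> span B" for v
    proof -
      have "q = (\<Sum>b\<in>B. (b \<bullet> p / (b \<bullet> b)) *\<^sub>R b)"
        unfolding q_def by (intro sum.cong) (auto simp: bb)
      then show ?thesis using Gram_Schmidt_step[OF B(1) that, of p] by simp
    qed
    have "q \<in> span B" unfolding q_def by (intro span_sum span_scale span_base)
    have "(norm p)\<^sup>2 = (norm q)\<^sup>2 + (norm (p - q))\<^sup>2"
      using norm_add_Pythagorean[OF orth[OF \<open>q \<in> span B\<close>]] by simp
    then have "norm (p - q) \<le> norm p"
      by (intro power2_le_imp_le[of "norm (p - q)"]) auto
    moreover have "p - q \<in> W"
      using orth B(4) by (auto simp: W_def orthogonal_def inner_commute span_base)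
    ultimately have 1: "p - q \<in> cball 0 t \<inter> W" using p by simp
    have "q - c = (\<Sum>b\<in>B. (b \<bullet> p + t) *\<^sub>R b)"
      by (simp add: q_def c_def sum.distrib[symmetric] scaleR_add_left)
    moreover have "(b \<bullet> p + t) *\<^sub>R b \<in> seg ((2 * t) *\<^sub>R b)" if "b \<in> B" for b
    proof -
      have "\<bar>b \<bullet> p\<bar> \<le> t"
        using Cauchy_Schwarz_ineq2[of b p] B(2)[OF that] p by simp
      then have "0 \<le> b \<bullet> p + t" "b \<bullet> p + t \<le> 2 * t" by auto
      then have "(b \<bullet> p + t) *\<^sub>R b \<in> {0} + seg ((2 * t) *\<^sub>R b)"
        using t by (subst in_set_plus_seg_scaleR_iff) auto
      then show ?thesis by (simp flip: set_zero)
    qed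
    ultimately have 2: "q - c \<in> Z"
      unfolding Z_def set_sum_alt[OF \<open>finite B\<close>] by blast
    have "p = c + ((p - q) + (q - c))" by simp
    then show "p \<in> {c} + (cball 0 t \<inter> W + Z)"
      using 1 2 by (metis insertI1 set_plus_intro)
  qed
  have "G (cball 0 t) \<le> G ({c} + (cball 0 t \<inter> W + Z))"
    using t body Z sub by (intro seg_affine_mono[OF G] convex_body_set_plus) auto
  also have "\<dots> = G (cball 0 t \<inter> W + Z)"
    using body Z by (intro seg_affine_translation[OF G] convex_body_set_plus)
  also have "\<dots> = G (cball 0 t \<inter> W)"
    unfolding Z_def using \<open>finite B\<close> null body by (rule null_directions_sum)
  finally have "G (cball 0 t) \<le> G (cball 0 t \<inter> W)" .
  moreover have "G (cball 0 t \<inter> W) \<le> G (cball 0 t)"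
    using t body by (intro seg_affine_mono[OF G]) auto
  ultimately show ?thesis by (simp add: G_def W_def)
qed

text \<open>All terms of the expansion are nonnegative. For a proper subset \<open>T\<close> the
  terms sum to \<open>F (P + (\<Sum>i\<in>T. seg (x i))) = 0\<close>, hence vanish one by one, and
  in the expansion for \<open>S\<close> only the term of \<open>S\<close> itself survives.\<close>

lemma mixed_diff_eq_top:
  assumes F: "seg_affine F" "\<And>P. convex_body P \<Longrightarrow> 0 \<le> F P" and S: "finite S" and P: "convex_body P"
    and zero: "\<And>T. T \<subset> S \<Longrightarrow> F (P + (\<Sum>i\<in>T. seg (x i))) = 0"
  shows "mixed_diff S x F P = F (P + (\<Sum>i\<in>S. seg (x i)))"
proof -
  have nonneg: "0 \<le> mixed_diff T x F P" if "T \<subseteq> S" for T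
    using that F P S finite_subset by (intro mixed_diff_nonneg) auto
  have "mixed_diff T x F P = 0" if T: "T \<subset> S" for T
  proof -
    have finT: "finite T" using T S finite_subset by auto
    have "mixed_diff T x F P \<le> (\<Sum>U\<in>Pow T. mixed_diff U x F P)"
      using finT T nonneg by (intro member_le_sum) auto
    also have "\<dots> = 0"
      using mixed_diff_expansion[OF finT, of F P x] zero[OF T] by simp
    finally show ?thesis using nonneg T by (simp add: order_antisym psubset_imp_subset)
  qed
  then have "(\<Sum>T\<in>Pow S. mixed_diff T x F P) = (\<Sum>T\<in>{S}. mixed_diff T x F P)"
    using S by (intro sum.mono_neutral_right) auto
  then show ?thesis using mixed_diff_expansion[OF S, of F P x] by simp
qed

subsection \<open>Linear images\<close>

text \<open>\<open>measure_linear_image\<close> is restricted to index types that carry a well-order.\<close>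

lemma measure_linear_image_cart:
  fixes f :: "real^'n \<Rightarrow> real^'n"
  assumes "linear f" and S: "S \<in> lmeasurable"
  shows "f ` S \<in> lmeasurable \<and> measure lebesgue (f ` S) = \<bar>det (matrix f)\<bar> * measure lebesgue S"
proof -
  define P :: "(real^'n \<Rightarrow> real^'n) \<Rightarrow> bool" where
    "P f \<longleftrightarrow> (\<forall>S \<in> lmeasurable. f ` S \<in> lmeasurable \<and>
      measure lebesgue (f ` S) = \<bar>det (matrix f)\<bar> * measure lebesgue S)" for f
  \<comment> \<open>Common to coordinate swaps and shears: the determinant has modulus 1, and it is
    enough that volumes of boxes are preserved.\<close>
  have unimodular: "P h" if h: "linear h" "\<bar>det (matrix h)\<bar> = 1"
    and box: "\<And>a b. measure lebesgue (h ` cbox a b) = measure lebesgue (cbox a b)"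
    for h :: "real^'n \<Rightarrow> real^'n"
    unfolding P_def
  proof
    fix S :: "(real^'n) set" assume "S \<in> lmeasurable"
    with measure_linear_sufficient[OF h(1), where m = 1] box
    have "h ` S \<in> lmeasurable \<and> 1 * measure lebesgue S = measure lebesgue (h ` S)"
      by (metis mult_1)
    then show "h ` S \<in> lmeasurable \<and> measure lebesgue (h ` S) = \<bar>det (matrix h)\<bar> * measure lebesgue S"
      unfolding h(2) by (simp only: mult_1)
  qed
  have "P f"
    using \<open>linear f\<close>
  proof (rule induct_linear_elementary[where P = P])
    fix f g :: "real^'n \<Rightarrow> real^'n"
    assume fg: "linear f" "linear g" "P f" "P g"
    show "P (f \<circ> g)"
      unfolding P_def
    proof
      fix S :: "(real^'n) set" assume S: "S \<in> lmeasurable"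
      have gS: "g ` S \<in> lmeasurable" "measure lebesgue (g ` S) = \<bar>det (matrix g)\<bar> * measure lebesgue S"
        using fg(4) S by (auto simp: P_def)
      have fgS: "f ` g ` S \<in> lmeasurable"
        "measure lebesgue (f ` g ` S) = \<bar>det (matrix f)\<bar> * measure lebesgue (g ` S)"
        using fg(3) gS(1) by (auto simp: P_def)
      have "\<bar>det (matrix (f \<circ> g))\<bar> = \<bar>det (matrix f)\<bar> * \<bar>det (matrix g)\<bar>"
        using matrix_compose[OF fg(2,1)] by (simp add: det_mul abs_mult)
      then show "(f \<circ> g) ` S \<in> lmeasurable \<and>
          measure lebesgue ((f \<circ> g) ` S) = \<bar>det (matrix (f \<circ> g))\<bar> * measure lebesgue S"
        unfolding image_comp[symmetric] using fgS gS by simp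
    qed
  next
    fix f :: "real^'n \<Rightarrow> real^'n" and i
    assume f: "linear f" and 0: "\<And>x. f x $ i = 0"
    have "f x \<noteq> axis i 1" for x
      using 0[of x] by (metis axis_nth zero_neq_one)
    then have "\<not> surj f" by (metis surjD)
    then have "\<not> inj f" using f linear_injective_imp_surjective by blast
    moreover from this have "det (matrix f) = 0" using det_nz_iff_inj[OF f] by blast
    ultimately show "P f"
      using negligible_linear_singular_image[OF f]
      by (auto simp: P_def negligible_iff_measure)
  next
    fix c :: "'n \<Rightarrow> real"
    have "matrix (\<lambda>x. \<chi> i. c i * x $ i) = (\<chi> i j. if i = j then c i else 0)"
      by (auto simp: matrix_def vec_eq_iff axis_def)
    then show "P (\<lambda>x. \<chi> i. c i * x $ i)"
      by (auto simp: P_def measure_stretch measurable_stretch det_diagonal)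
  next
    fix m n :: 'n
    let ?h = "\<lambda>x :: real^'n. \<chi> i. x $ Transposition.transpose m n i"
    show "P ?h"
    proof (rule unimodular)
      show "linear ?h" by (rule linearI) (simp_all add: vec_eq_iff)
      have "matrix ?h = (\<chi> i. mat 1 $ Transposition.transpose m n i)"
        by (auto simp: matrix_def vec_eq_iff axis_def mat_def)
      then show "\<bar>det (matrix ?h)\<bar> = 1"
        by (simp add: det_permute_rows permutes_swap_id sign_swap_id abs_mult)
      fix a b :: "real^'n"
      have "?h ` cbox a b = cbox (?h a) (?h b)"
      proof (intro subset_antisym subsetI)
        fix y assume "y \<in> cbox (?h a) (?h b)"
        then have y: "a $ Transposition.transpose m n i \<le> y $ i \<and> y $ i \<le> b $ Transposition.transpose m n i" for i
          by (simp add: mem_box_cart)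
        have "?h y \<in> cbox a b"
          unfolding mem_box_cart using y[of "Transposition.transpose m n _"] by simp
        then show "y \<in> ?h ` cbox a b"
          by (rule image_eqI[rotated]) (simp add: vec_eq_iff)
      qed (auto simp: mem_box_cart)
      moreover have "cbox (?h a) (?h b) = {} \<longleftrightarrow> cbox a b = {}"
        using calculation by blast
      moreover have "(\<Prod>i\<in>UNIV. b $ Transposition.transpose m n i - a $ Transposition.transpose m n i)
          = (\<Prod>i\<in>UNIV. b $ i - a $ i)"
        using prod.permute[of "Transposition.transpose m n" UNIV "\<lambda>i. b $ i - a $ i"]
        by (simp add: permutes_swap_id o_def)
      ultimately show "measure lebesgue (?h ` cbox a b) = measure lebesgue (cbox a b)"
        by (simp add: content_cbox_if_cart)
    qed
  next
    fix m n :: 'n assume mn: "m \<noteq> n"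
    let ?h = "\<lambda>x :: real^'n. \<chi> i. if i = m then x $ m + x $ n else x $ i"
    show "P ?h"
    proof (rule unimodular)
      show lin: "linear ?h" by (rule linearI) (auto simp: vec_eq_iff algebra_simps)
      have "matrix ?h = (\<chi> k. if k = m then row m (mat 1) + 1 *s row n (mat 1) else row k (mat 1))"
        by (auto simp: matrix_def vec_eq_iff axis_def mat_def row_def)
      then show "\<bar>det (matrix ?h)\<bar> = 1"
        by (simp only: det_row_operation[OF mn]) simp
      fix a b :: "real^'n"
      show "measure lebesgue (?h ` cbox a b) = measure lebesgue (cbox a b)"
      proof (cases "cbox a b = {}")
        case False
        \<comment> \<open>\<open>measure_shear_interval\<close> is applied to a box with lower
          corner 0; linearity of the shear turns the translation by \<open>a\<close> into one by the
          image of \<open>a\<close>.\<close>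
        have shift: "cbox a b = (+) a ` cbox 0 (b - a)"
          using cbox_translation[of a 0 "b - a"] by simp
        have "?h ` cbox a b = (+) (?h a) ` ?h ` cbox 0 (b - a)"
          unfolding shift image_image by (intro image_cong refl linear_add[OF lin])
        then have "measure lebesgue (?h ` cbox a b) = measure lebesgue (cbox 0 (b - a))"
          using False measure_shear_interval[OF mn, of 0 "b - a"]
          by (simp add: measure_translation shift)
        then show ?thesis
          unfolding shift measure_translation .
      qed simp
    qed
  qed
  then show ?thesis using S by (simp add: P_def)
qed

subsection \<open>Gram determinants\<close>

text \<open>Leibniz' formula for the determinant of the matrix of inner products. The index set is a
  set and not a type because subsets of varying size are summed over.\<close>

definition gram_det :: "'i set \<Rightarrow> ('i \<Rightarrow> 'a::real_inner) \<Rightarrow> real" where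
  "gram_det S x = (\<Sum>p | p permutes S. of_int (sign p) * (\<Prod>i\<in>S. x i \<bullet> x (p i)))"

lemma gram_det_columns:
  fixes A :: "real^'j^'d"
  shows "gram_det UNIV (\<lambda>k. column k A) = det (transpose A ** A)"
  by (simp add: gram_det_def det_def matrix_matrix_mult_def transpose_def column_def inner_vec_def)

lemma gram_det_cong: "(\<And>i. i \<in> S \<Longrightarrow> x i = y i) \<Longrightarrow> gram_det S x = gram_det S y"
  unfolding gram_det_def
  by (intro sum.cong refl arg_cong2[where f = "(*)"] prod.cong) (auto simp: permutes_in_image)

lemma gram_det_reindex:
  assumes h: "inj_on h S" and S: "finite S"
  shows "gram_det (h ` S) x = gram_det S (x \<circ> h)"
proof -
  have bij: "bij_betw h S (h ` S)" using h by (simp add: bij_betw_def)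
  have bij': "bij_betw (inv_into S h) (h ` S) S" using bij by (rule bij_betw_inv_into)
  show ?thesis unfolding gram_det_def
  proof (rule sum.reindex_bij_witness[of _ "map_permutation S h" "map_permutation (h ` S) (inv_into S h)"])
    fix p assume "p \<in> {p. p permutes h ` S}"
    then have p: "p permutes h ` S" by simp
    show q: "map_permutation (h ` S) (inv_into S h) p \<in> {p. p permutes S}"
      using map_permutation_permutes[OF bij' p] by simp
    show inv: "map_permutation S h (map_permutation (h ` S) (inv_into S h) p) = p"
      by (rule map_permutation_compose_inv[OF bij' p]) (simp add: f_inv_into_f)
    define q where "q = map_permutation (h ` S) (inv_into S h) p"
    have q: "q permutes S" "map_permutation S h q = p" using q inv by (auto simp: q_def)
    have "sign p = sign q"
      using sign_map_permutation[OF h q(1) S] q(2) by simp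
    moreover have "(\<Prod>i\<in>S. (x \<circ> h) i \<bullet> (x \<circ> h) (q i)) = (\<Prod>i\<in>h ` S. x i \<bullet> x (p i))"
      unfolding prod.reindex[OF h] q(2)[symmetric]
      by (intro prod.cong refl) (simp add: map_permutation_apply[OF h])
    ultimately show "of_int (sign q) * (\<Prod>i\<in>S. (x \<circ> h) i \<bullet> (x \<circ> h) (q i)) =
        of_int (sign p) * (\<Prod>i\<in>h ` S. x i \<bullet> x (p i))" by simp
  next
    fix p assume "p \<in> {p. p permutes S}"
    then have p: "p permutes S" by simp
    show "map_permutation S h p \<in> {p. p permutes h ` S}"
      using map_permutation_permutes[OF bij p] by simp
    show "map_permutation (h ` S) (inv_into S h) (map_permutation S h p) = p"
      by (rule map_permutation_compose_inv[OF bij p]) (simp add: h)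
  qed
qed

text \<open>The Gram matrix is block diagonal with an identity block on \<open>T - S\<close>: a
  permutation moving an index of that block meets a factor 0, and one fixing the block pointwise
  collects factors 1 there.\<close>

lemma gram_det_extend_orthonormal:
  assumes T: "finite T" "S \<subseteq> T"
    and one: "\<And>a. a \<in> T - S \<Longrightarrow> w a \<bullet> w a = 1"
    and orth: "\<And>a b. a \<in> T - S \<Longrightarrow> b \<in> T \<Longrightarrow> b \<noteq> a \<Longrightarrow> w a \<bullet> w b = 0"
  shows "gram_det T w = gram_det S w"
proof -
  have "(\<Sum>p | p permutes T. of_int (sign p) * (\<Prod>i\<in>T. w i \<bullet> w (p i))) =
      (\<Sum>p | p permutes S. of_int (sign p) * (\<Prod>i\<in>T. w i \<bullet> w (p i)))"
  proof (rule sum.mono_neutral_right)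
    show "finite {p. p permutes T}" using T by (simp add: finite_permutations)
    show "{p. p permutes S} \<subseteq> {p. p permutes T}" using T by (auto intro: permutes_subset)
    show "\<forall>p\<in>{p. p permutes T} - {p. p permutes S}. of_int (sign p) * (\<Prod>i\<in>T. w i \<bullet> w (p i)) = 0"
    proof
      fix p assume p: "p \<in> {p. p permutes T} - {p. p permutes S}"
      then obtain a where a: "a \<in> T - S" "p a \<noteq> a"
        using permutes_superset[of p T S] by auto
      then have "w a \<bullet> w (p a) = 0"
        using p by (intro orth) (auto simp: permutes_in_image)
      then have "(\<Prod>i\<in>T. w i \<bullet> w (p i)) = 0"
        using T a by (auto intro!: prod_zero)
      then show "of_int (sign p) * (\<Prod>i\<in>T. w i \<bullet> w (p i)) = 0" by simp
    qed
  qed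
  also have "\<dots> = gram_det S w"
    unfolding gram_det_def
  proof (intro sum.cong refl arg_cong2[where f = "(*)"])
    fix p assume p: "p \<in> {p. p permutes S}"
    have "(\<Prod>i\<in>T. w i \<bullet> w (p i)) = (\<Prod>i\<in>S. w i \<bullet> w (p i)) * (\<Prod>i\<in>T - S. w i \<bullet> w (p i))"
      using T by (subst prod.subset_diff[of S T]) (auto simp: mult.commute)
    also have "(\<Prod>i\<in>T - S. w i \<bullet> w (p i)) = 1"
      using p one by (intro prod.neutral) (auto simp: permutes_not_in)
    finally show "(\<Prod>i\<in>T. w i \<bullet> w (p i)) = (\<Prod>i\<in>S. w i \<bullet> w (p i))" by simp
  qed
  finally show ?thesis by (simp add: gram_det_def)
qed

subsection \<open>The volume of a cylinder\<close>

text \<open>\<open>lborel\<close> is the image of the product measure over \<open>Basis\<close>.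
  Splitting the coordinates into \<open>I\<close> and the rest makes the cylinder a product of a
  unit cube and a ball of radius \<open>t\<close>.\<close>

lemma emeasure_cylinder:
  fixes I :: "'a::euclidean_space set"
  assumes I: "I \<subseteq> Basis" and t: "0 < t"
  shows "emeasure lborel {v::'a. (\<forall>b\<in>I. 0 \<le> v \<bullet> b \<and> v \<bullet> b \<le> 1) \<and> (\<Sum>b\<in>Basis - I. (v \<bullet> b)\<^sup>2) \<le> t\<^sup>2}
    = ennreal (unit_ball_vol (real (DIM('a) - card I)) * t ^ (DIM('a) - card I))" (is "emeasure _ ?C = _")
proof -
  interpret product_sigma_finite "\<lambda>_::'a. lborel :: real measure" ..
  let ?L = "\<lambda>_::'a. lborel :: real measure"
  define J where "J = Basis - I"
  have fin: "finite I" "finite J" using finite_subset[OF I] by (auto simp: J_def)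
  have IJ: "I \<inter> J = {}" "I \<union> J = Basis" using I by (auto simp: J_def)
  interpret I: finite_product_sigma_finite "\<lambda>_::'a. lborel :: real measure" I by standard fact
  interpret J: finite_product_sigma_finite "\<lambda>_::'a. lborel :: real measure" J by standard fact
  have "closed ?C"
    unfolding Collect_conj_eq Collect_ball_eq
    by (intro closed_Int closed_INT ballI closed_Collect_le continuous_intros)
  then have C [measurable]: "?C \<in> sets borel" by simp
  let ?E = "PiE I (\<lambda>_. {0..1::real})"
  \<comment> \<open>The ball in the form of \<open>emeasure_cball_aux\<close>, which also covers
    empty \<open>J\<close>.\<close>
  let ?D = "{f. sqrt (\<Sum>b\<in>J. (f b)\<^sup>2) \<le> t} \<inter> space (PiM J ?L)"
  have D: "?D \<in> sets (PiM J ?L)"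
  proof -
    have "(\<lambda>f. sqrt (\<Sum>b\<in>J. (f b)\<^sup>2)) \<in> borel_measurable (PiM J ?L)"
      by measurable
    then have "{f \<in> space (PiM J ?L). sqrt (\<Sum>b\<in>J. (f b)\<^sup>2) \<le> t} \<in> sets (PiM J ?L)"
      by measurable
    then show ?thesis by (simp add: Int_def conj_commute)
  qed
  have pre: "(\<lambda>f. \<Sum>b\<in>Basis. f b *\<^sub>R b) -` ?C \<inter> space (PiM Basis ?L) \<in> sets (PiM Basis ?L)"
    by (rule measurable_sets[OF _ C]) measurable
  have "emeasure lborel ?C = emeasure (distr (PiM Basis ?L) borel (\<lambda>f. \<Sum>b\<in>Basis. f b *\<^sub>R b)) ?C"
    by (subst lborel_eq) simp
  also have "\<dots> = emeasure (PiM Basis ?L)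
      ((\<lambda>f. \<Sum>b\<in>Basis. f b *\<^sub>R b) -` ?C \<inter> space (PiM Basis ?L))"
    by (rule emeasure_distr) auto
  also have "PiM Basis ?L =
      distr (PiM I ?L \<Otimes>\<^sub>M PiM J ?L) (PiM Basis ?L) (merge I J)"
    using distr_merge[OF IJ(1) fin] by (simp only: IJ(2))
  also have "emeasure \<dots> ((\<lambda>f. \<Sum>b\<in>Basis. f b *\<^sub>R b) -` ?C \<inter> space \<dots>) =
    emeasure (PiM I ?L \<Otimes>\<^sub>M PiM J ?L)
     (merge I J -` ((\<lambda>f. \<Sum>b\<in>Basis. f b *\<^sub>R b) -` ?C \<inter> space (PiM Basis ?L))
       \<inter> space (PiM I ?L \<Otimes>\<^sub>M PiM J ?L))"
    unfolding space_distr using measurable_merge[of I J "\<lambda>_. lborel :: real measure"] IJ(2)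
    by (intro emeasure_distr pre) simp
  also have "(merge I J -` ((\<lambda>f. \<Sum>b\<in>Basis. f b *\<^sub>R b) -` ?C \<inter> space (PiM Basis ?L))
       \<inter> space (PiM I ?L \<Otimes>\<^sub>M PiM J ?L)) = ?E \<times> ?D"
  proof -
    have "merge I J (f, g) \<in> (\<lambda>f. \<Sum>b\<in>Basis. f b *\<^sub>R b) -` ?C \<longleftrightarrow>
        (\<forall>b\<in>I. 0 \<le> f b \<and> f b \<le> 1) \<and> sqrt (\<Sum>b\<in>J. (g b)\<^sup>2) \<le> t" for f g :: "'a \<Rightarrow> real"
    proof -
      have 1: "(\<Sum>c\<in>Basis. h c *\<^sub>R c) \<bullet> b = h b" if "b \<in> Basis" for h :: "'a \<Rightarrow> real" and b
        using that by simp
      have "(\<Sum>b\<in>J. ((\<Sum>c\<in>Basis. merge I J (f, g) c *\<^sub>R c) \<bullet> b)\<^sup>2) = (\<Sum>b\<in>J. (g b)\<^sup>2)"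
        by (intro sum.cong refl) (subst 1, auto simp: J_def merge_def)
      moreover have "(\<Sum>c\<in>Basis. merge I J (f, g) c *\<^sub>R c) \<bullet> b = f b" if "b \<in> I" for b
        using that I by (subst 1) (auto simp: merge_def)
      moreover have "sqrt (\<Sum>b\<in>J. (g b)\<^sup>2) \<le> t \<longleftrightarrow> (\<Sum>b\<in>J. (g b)\<^sup>2) \<le> t\<^sup>2"
        using t by (metis abs_of_pos real_sqrt_abs real_sqrt_le_iff)
      ultimately show ?thesis
        unfolding vimage_eq mem_Collect_eq J_def[symmetric] by simp
    qed
    note in_C = this
    define X where "X = (\<lambda>f. \<Sum>b\<in>Basis. f b *\<^sub>R b) -` ?C"
    have space: "merge I J z \<in> space (PiM Basis ?L)" if "z \<in> space (PiM I ?L \<Otimes>\<^sub>M PiM J ?L)" for z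
      using measurable_space[OF measurable_merge that] IJ(2) by simp
    have E: "f \<in> ?E \<longleftrightarrow> f \<in> space (PiM I ?L) \<and> (\<forall>b\<in>I. 0 \<le> f b \<and> f b \<le> 1)" for f
      by (auto simp: space_PiM PiE_iff)
    have "(f, g) \<in> merge I J -` (X \<inter> space (PiM Basis ?L)) \<inter> space (PiM I ?L \<Otimes>\<^sub>M PiM J ?L) \<longleftrightarrow>
        (f, g) \<in> ?E \<times> ?D" for f g
      using in_C[of f g, folded X_def] E[of f] space[of "(f, g)"]
      unfolding mem_Sigma_iff Int_iff vimage_eq space_pair_measure mem_Collect_eq by blast
    then show ?thesis unfolding X_def by auto
  qed
  also have "emeasure (PiM I ?L \<Otimes>\<^sub>M PiM J ?L) (?E \<times> ?D) =
      emeasure (PiM I ?L) ?E * emeasure (PiM J ?L) ?D"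
    using D fin by (intro J.emeasure_pair_measure_Times) (auto intro!: sets_PiM_I_finite)
  also have "emeasure (PiM I ?L) ?E = 1"
    using fin by (subst emeasure_PiM) auto
  also have "emeasure (PiM J ?L) ?D = ennreal (unit_ball_vol (real (card J)) * t ^ card J)"
    using fin t by (intro emeasure_cball_aux)
  also have "card J = DIM('a) - card I"
    using I fin by (simp add: J_def card_Diff_subset)
  finally show ?thesis by simp
qed

subsection \<open>Mixed differences of the volume at a ball\<close>

text \<open>\<open>independent\<close> sees only the set of values. A repeated vector lies in the
  span of the remaining family, so the indexed condition yields injectivity as well.\<close>

lemma not_dependent_family:
  fixes x :: "'i \<Rightarrow> 'a::real_vector"
  assumes "\<And>i. i \<in> S \<Longrightarrow> x i \<notin> span (x ` (S - {i}))"
  shows "inj_on x S" "independent (x ` S)"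
proof -
  show inj: "inj_on x S"
  proof (rule inj_onI)
    fix i j assume ij: "i \<in> S" "j \<in> S" "x i = x j"
    show "i = j"
    proof (rule ccontr)
      assume "i \<noteq> j"
      then have "x j \<in> span (x ` (S - {i}))" using ij by (auto intro: span_base)
      then show False using assms[OF ij(1)] ij(3) by simp
    qed
  qed
  show "independent (x ` S)"
    unfolding dependent_def
  proof safe
    fix i assume i: "i \<in> S" "x i \<in> span (x ` S - {x i})"
    have "x ` S - {x i} \<subseteq> x ` (S - {i})" by auto
    then show False using i assms[of i] span_mono by blast
  qed
qed

lemma orthonormal_completion:
  fixes x :: "'i \<Rightarrow> real^'d"
  assumes S: "finite S" and k: "card S \<le> CARD('d)"
  obtains e :: "'i \<Rightarrow> 'd" and w :: "'d \<Rightarrow> real^'d"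
  where "inj_on e S" "\<And>i. i \<in> S \<Longrightarrow> w (e i) = x i"
    "\<And>a. a \<notin> e ` S \<Longrightarrow> w a \<bullet> w a = 1"
    "\<And>a b. a \<notin> e ` S \<Longrightarrow> b \<noteq> a \<Longrightarrow> w a \<bullet> w b = 0"
proof -
  obtain e :: "'i \<Rightarrow> 'd" where e: "inj_on e S"
    using card_le_inj[OF S finite_class.finite_UNIV k] by blast
  define W where "W = {y. \<forall>u\<in>span (x ` S). orthogonal u y}"
  have W: "dim W + dim (span (x ` S)) = CARD('d)"
    using dim_subspace_orthogonal_to_vectors[of "span (x ` S)" UNIV] by (simp add: W_def)
  have "subspace W" by (auto simp: W_def subspace_def orthogonal_def inner_add_right)
  then obtain B where B: "B \<subseteq> W" "pairwise orthogonal B" "\<And>b. b \<in> B \<Longrightarrow> norm b = 1"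
      "independent B" "card B = dim W"
    using orthonormal_basis_subspace by metis
  have "finite B" using B(4) by (rule independent_imp_finite)
  have "dim (span (x ` S)) \<le> card S"
    using dim_le_card'[of "x ` S"] S card_image_le[OF S, of x] by simp
  then have "card (- e ` S) \<le> card B"
    using W B(5) card_image[OF e] by (simp add: Compl_eq_Diff_UNIV card_Diff_subset)
  then obtain g where g: "g ` (- e ` S) \<subseteq> B" "inj_on g (- e ` S)"
    using card_le_inj[of "- e ` S" B] \<open>finite B\<close> by auto
  define w where "w a = (if a \<in> e ` S then x (inv_into S e a) else g a)" for a
  show thesis
  proof (rule that[OF e])
    show "w (e i) = x i" if "i \<in> S" for i using that e by (simp add: w_def)
    show "w a \<bullet> w a = 1" if "a \<notin> e ` S" for a
      using that g B(3)[of "g a"] by (auto simp: w_def norm_eq_1)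
    show "w a \<bullet> w b = 0" if a: "a \<notin> e ` S" and "b \<noteq> a" for a b
    proof (cases "b \<in> e ` S")
      case True
      then have "w b \<in> span (x ` S)" using e by (auto simp: w_def intro: span_base)
      moreover have "w a \<in> W" using a g B(1) by (auto simp: w_def)
      ultimately show ?thesis by (auto simp: W_def orthogonal_def inner_commute)
    next
      case False
      then have "g a \<in> B" "g b \<in> B" "g a \<noteq> g b"
        using that g by (auto dest: inj_onD)
      then show ?thesis using B(2) False a by (auto simp: w_def pairwise_def orthogonal_def)
    qed
  qed
qed

text \<open>The columns of \<open>A\<close> are the vectors \<open>x i\<close>, placed by \<open>e\<close>, and an orthonormal family orthogonal
  to them. Then \<open>gram_det S x = (det A)\<^sup>2\<close>, and \<open>A\<close> maps a cylinder onto the sum of the segments and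
  of the section of the ball orthogonal to them.\<close>

lemma mixed_diff_measure_cball:
  fixes x :: "'i \<Rightarrow> real^'d"
  assumes S: "finite S" and t: "0 < t"
  shows "mixed_diff S x (measure lebesgue) (cball 0 t) =
    (if card S \<le> CARD('d) then
       t ^ (CARD('d) - card S) * unit_ball_vol (real (CARD('d) - card S)) * sqrt (gram_det S x)
     else 0)"
proof (cases "card S \<le> CARD('d)")
  case False
  have "\<exists>i\<in>S. x i \<in> span (x ` (S - {i}))"
  proof (rule ccontr)
    assume "\<not> ?thesis"
    then have "inj_on x S" "independent (x ` S)" using not_dependent_family[of S x] by auto
    then have "card S \<le> CARD('d)"
      using independent_bound[of "x ` S"] by (simp add: card_image)
    with False show False by simp
  qed
  then show ?thesis
    using False mixed_diff_eq_0_dependent[OF seg_affine_measure S, of _ x "cball 0 t"] t by auto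
next
  case True
  obtain e :: "'i \<Rightarrow> 'd" and w :: "'d \<Rightarrow> real^'d"
    where e: "inj_on e S" and we: "\<And>i. i \<in> S \<Longrightarrow> w (e i) = x i"
      and one: "\<And>a. a \<notin> e ` S \<Longrightarrow> w a \<bullet> w a = 1"
      and orth: "\<And>a b. a \<notin> e ` S \<Longrightarrow> b \<noteq> a \<Longrightarrow> w a \<bullet> w b = 0"
    using orthonormal_completion[OF S True] by metis
  define A :: "real^'d^'d" where "A = (\<chi> i a. w a $ i)"
  define f where "f = (\<lambda>v. A *v v)"
  have f: "linear f" by (simp add: f_def)
  have col: "column a A = w a" for a by (simp add: A_def column_def vec_eq_iff)
  have fv: "f v = (\<Sum>a\<in>UNIV. v $ a *\<^sub>R w a)" for v
    by (simp add: f_def matrix_mult_sum col scalar_mult_eq_scaleR)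
  have faxis: "f (axis a 1) = w a" for a
    by (simp add: f_def matrix_vector_mult_basis col)
  have det_f: "det (matrix f) = det A" by (simp add: f_def)
  have "gram_det S x = gram_det S (w \<circ> e)" by (rule gram_det_cong) (simp add: we)
  also have "\<dots> = gram_det (e ` S) w" using e S by (simp add: gram_det_reindex)
  also have "\<dots> = gram_det UNIV w"
    using one orth by (intro gram_det_extend_orthonormal[symmetric]) auto
  also have "\<dots> = (det A)\<^sup>2"
    using gram_det_columns[of A] by (simp add: col det_mul power2_eq_square)
  finally have gram: "sqrt (gram_det S x) = \<bar>det A\<bar>" by simp
  show ?thesis
  proof (cases "\<exists>i\<in>S. x i \<in> span (x ` (S - {i}))")
    case dep: True
    then obtain i where i: "i \<in> S" "x i \<in> span (x ` (S - {i}))" by blast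
    \<comment> \<open>Through an injective \<open>f\<close>, the dependence of \<open>x i\<close> on
      the other vectors would pull back to one among distinct axis vectors.\<close>
    have "\<not> inj f"
    proof
      assume inj: "inj f"
      let ?B = "(\<lambda>j. axis (e j) (1::real)) ` (S - {i})"
      have "x ` (S - {i}) = f ` ?B"
        by (auto simp: image_image faxis we)
      then have "f (axis (e i) 1) \<in> f ` span ?B"
        using i by (simp add: faxis we linear_span_image[OF f])
      then have "axis (e i) 1 \<in> span ?B"
        using inj by (simp add: inj_image_mem_iff)
      moreover have "?B \<subseteq> Basis - {axis (e i) 1}"
        using e i by (auto simp: axis_eq_axis inj_on_def axis_in_Basis_iff)
      ultimately have "axis (e i) (1::real) \<in> span (Basis - {axis (e i) 1})"
        using span_mono by blast
      then show False
        using independent_Basis unfolding dependent_def by (auto simp: axis_in_Basis_iff)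
    qed
    then have "det A = 0" using det_nz_iff_inj[OF f] det_f by simp
    moreover have "mixed_diff S x (measure lebesgue) (cball 0 t) = 0"
      using t i by (intro mixed_diff_eq_0_dependent[OF seg_affine_measure S]) auto
    ultimately show ?thesis using gram by simp
  next
    case False
    then have ind: "inj_on x S" "independent (x ` S)" using not_dependent_family[of S x] by auto
    define Q where "Q = cball 0 t \<inter> {v. \<forall>i\<in>S. v \<bullet> x i = 0}"
    define I where "I = e ` S"
    have orth_sum: "(\<Sum>b\<in>UNIV - I. c b *\<^sub>R w b) \<bullet> w a = (if a \<in> I then 0 else c a)" for c a
    proof -
      have "(\<Sum>b\<in>UNIV - I. c b *\<^sub>R w b) \<bullet> w a = (\<Sum>b\<in>UNIV - I. if b = a then c b else 0)"
        unfolding inner_sum_left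
        by (rule sum.cong) (auto simp: one orth I_def)
      then show ?thesis by simp
    qed
    have norm_sum: "(norm (\<Sum>b\<in>UNIV - I. c b *\<^sub>R w b))\<^sup>2 = (\<Sum>b\<in>UNIV - I. (c b)\<^sup>2)" for c
    proof -
      have "(norm (\<Sum>b\<in>UNIV - I. c b *\<^sub>R w b))\<^sup>2 =
          (\<Sum>b\<in>UNIV - I. c b * ((\<Sum>b\<in>UNIV - I. c b *\<^sub>R w b) \<bullet> w b))"
        unfolding power2_norm_eq_inner by (simp only: inner_sum_right inner_scaleR_right)
      also have "\<dots> = (\<Sum>b\<in>UNIV - I. (c b)\<^sup>2)"
        by (rule sum.cong) (auto simp: orth_sum power2_eq_square)
      finally show ?thesis .
    qed
    \<comment> \<open>The remainder of the orthonormal expansion is orthogonal to every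
      \<open>w a\<close>. These vectors span the whole space, since independence of the
      \<open>x i\<close> makes \<open>f\<close> injective and hence onto, so the remainder is
      0.\<close>
    have spanning: "v = (\<Sum>b\<in>UNIV - I. (v \<bullet> w b) *\<^sub>R w b)" if v: "\<forall>i\<in>S. v \<bullet> x i = 0" for v
    proof -
      have "inj f"
      proof (subst linear_injective_0[OF f], safe)
        fix u assume u: "f u = 0"
        have split: "f u = (\<Sum>a\<in>UNIV - I. u $ a *\<^sub>R w a) + (\<Sum>a\<in>I. u $ a *\<^sub>R w a)"
          unfolding fv by (rule sum.subset_diff) auto
        have zero: "u $ a = 0" if "a \<notin> I" for a
        proof -
          have "w b \<bullet> w a = 0" if "b \<in> I" for b
            using orth[of a b] \<open>a \<notin> I\<close> that by (auto simp: I_def inner_commute)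
          then have "(\<Sum>b\<in>I. u $ b *\<^sub>R w b) \<bullet> w a = 0"
            by (simp add: inner_sum_left)
          then have "f u \<bullet> w a = u $ a"
            unfolding split inner_add_left orth_sum using that by simp
          then show ?thesis using u by simp
        qed
        have "(\<Sum>a\<in>I. u $ a *\<^sub>R w a) = 0"
          using split u zero by simp
        then have "(\<Sum>i\<in>S. u $ e i *\<^sub>R x i) = 0"
          unfolding I_def sum.reindex[OF e] by (simp add: we)
        then have "(\<Sum>y\<in>x ` S. u $ e (inv_into S x y) *\<^sub>R y) = 0"
          unfolding sum.reindex[OF ind(1)] using ind(1) by simp
        then have "u $ e i = 0" if "i \<in> S" for i
          using ind S that independentD[of "x ` S" "x ` S" "\<lambda>y. u $ e (inv_into S x y)" "x i"]
          by simp
        then have "u $ a = 0" for a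
          using zero[of a] by (cases "a \<in> I") (auto simp: I_def)
        then show "u = 0" by (simp add: vec_eq_iff)
      qed
      then have "surj f" using linear_injective_imp_surjective[OF f] by blast
      define r where "r = v - (\<Sum>b\<in>UNIV - I. (v \<bullet> w b) *\<^sub>R w b)"
      have "r \<bullet> w a = 0" for a
      proof (cases "a \<in> I")
        case True
        then have "v \<bullet> w a = 0" using v we by (auto simp: I_def)
        then show ?thesis using True by (simp add: r_def inner_diff_left orth_sum)
      qed (simp add: r_def inner_diff_left orth_sum)
      moreover obtain u where "r = f u" using \<open>surj f\<close> by blast
      ultimately have "r \<bullet> r = 0"
        by (metis (no_types, lifting) fv inner_scaleR_right inner_sum_right mult_zero_right sum.neutral)
      then show ?thesis by (simp add: r_def)
    qed
    have body: "convex_body Q"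
      unfolding Q_def using t by (intro convex_body_cball_Int_orthogonal) simp
    \<comment> \<open>The vanishing premise of \<open>mixed_diff_eq_top\<close>: the set lies in the
      span of at most \<open>CARD('d) - card S + card T\<close> vectors, fewer than
      \<open>CARD('d)\<close>.\<close>
    have lower: "measure lebesgue (Q + (\<Sum>i\<in>T. seg (x i))) = 0" if T: "T \<subset> S" for T
    proof -
      have finT: "finite T" using T S finite_subset by auto
      let ?G = "w ` (UNIV - I) \<union> x ` T"
      have "Q + (\<Sum>i\<in>T. seg (x i)) \<subseteq> span ?G"
      proof
        fix z assume "z \<in> Q + (\<Sum>i\<in>T. seg (x i))"
        then obtain q s where z: "z = q + (\<Sum>i\<in>T. s i)" "q \<in> Q" "\<forall>i\<in>T. s i \<in> seg (x i)"
          unfolding set_sum_alt[OF finT] by (auto elim!: set_plus_elim)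
        have "q = (\<Sum>b\<in>UNIV - I. (q \<bullet> w b) *\<^sub>R w b)"
          using z(2) by (intro spanning) (simp add: Q_def)
        moreover have "(\<Sum>b\<in>UNIV - I. (q \<bullet> w b) *\<^sub>R w b) \<in> span ?G"
          by (intro span_sum span_scale span_base) auto
        moreover have "s i \<in> span ?G" if "i \<in> T" for i
        proof -
          obtain u where "s i = u *\<^sub>R x i" using z(3) \<open>i \<in> T\<close> by (auto simp: closed_segment_def)
          then show ?thesis using that by (simp add: span_scale span_base)
        qed
        ultimately show "z \<in> span ?G" unfolding z(1) by (auto intro!: span_add span_sum)
      qed
      then have "dim (Q + (\<Sum>i\<in>T. seg (x i))) \<le> card ?G"
        using finT by (intro dim_le_card) auto
      also have "\<dots> \<le> card (UNIV - I) + card T"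
        using finT by (intro order_trans[OF card_Un_le] add_mono card_image_le) auto
      also have "\<dots> < DIM(real^'d)"
        using psubset_card_mono[OF S T] True card_image[OF e] by (simp add: I_def card_Diff_subset)
      finally show ?thesis
        by (intro negligible_imp_measure0 negligible_lowdim)
    qed
    define C where "C = {v::real^'d. (\<forall>b\<in>(\<lambda>a. axis a 1) ` I. 0 \<le> v \<bullet> b \<and> v \<bullet> b \<le> 1) \<and>
        (\<Sum>b\<in>Basis - (\<lambda>a. axis a 1) ` I. (v \<bullet> b)\<^sup>2) \<le> t\<^sup>2}"
    have inj_axis: "inj_on (\<lambda>a::'d. axis a (1::real)) X" for X
      by (auto simp: inj_on_def axis_eq_axis)
    have C_iff: "v \<in> C \<longleftrightarrow> (\<forall>i\<in>S. 0 \<le> v $ e i \<and> v $ e i \<le> 1) \<and> (\<Sum>a\<in>UNIV - I. (v $ a)\<^sup>2) \<le> t\<^sup>2" for v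
    proof -
      have "Basis - (\<lambda>a::'d. axis a (1::real)) ` I = (\<lambda>a. axis a 1) ` (UNIV - I)"
        by (auto simp: Basis_vec_def axis_eq_axis)
      then have "(\<Sum>b\<in>Basis - (\<lambda>a. axis a 1) ` I. (v \<bullet> b)\<^sup>2) = (\<Sum>a\<in>UNIV - I. (v $ a)\<^sup>2)"
        by (simp add: sum.reindex[OF inj_axis] inner_axis)
      then show ?thesis by (simp add: C_def inner_axis I_def)
    qed
    have image: "Q + (\<Sum>i\<in>S. seg (x i)) = f ` C"
    proof (intro subset_antisym subsetI)
      fix z assume "z \<in> Q + (\<Sum>i\<in>S. seg (x i))"
      then obtain q s where z: "z = q + (\<Sum>i\<in>S. s i)" "q \<in> Q" "\<forall>i\<in>S. s i \<in> seg (x i)"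
        unfolding set_sum_alt[OF S] by (auto elim!: set_plus_elim)
      have "\<forall>i\<in>S. \<exists>u. 0 \<le> u \<and> u \<le> 1 \<and> s i = u *\<^sub>R x i"
        using z(3) by (auto simp: closed_segment_def)
      then obtain u where u: "\<And>i. i \<in> S \<Longrightarrow> 0 \<le> u i \<and> u i \<le> 1 \<and> s i = u i *\<^sub>R x i" by metis
      define v :: "real^'d" where "v = (\<chi> a. if a \<in> I then u (inv_into S e a) else q \<bullet> w a)"
      have ve: "v $ e i = u i" if "i \<in> S" for i using that e by (simp add: v_def I_def)
      have vn: "v $ a = q \<bullet> w a" if "a \<notin> I" for a using that by (simp add: v_def)
      have q: "q = (\<Sum>b\<in>UNIV - I. (q \<bullet> w b) *\<^sub>R w b)"
        using z(2) by (intro spanning) (simp add: Q_def)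
      have "(\<Sum>a\<in>UNIV - I. (v $ a)\<^sup>2) = (norm q)\<^sup>2"
        using norm_sum[of "\<lambda>b. q \<bullet> w b"] unfolding q[symmetric] by (simp add: vn)
      also have "\<dots> \<le> t\<^sup>2" using z(2) by (intro power_mono) (auto simp: Q_def)
      finally have "v \<in> C" unfolding C_iff using ve u by simp
      moreover have "f v = z"
      proof -
        have "f v = (\<Sum>a\<in>UNIV - I. v $ a *\<^sub>R w a) + (\<Sum>a\<in>I. v $ a *\<^sub>R w a)"
          unfolding fv by (rule sum.subset_diff) auto
        also have "(\<Sum>a\<in>UNIV - I. v $ a *\<^sub>R w a) = q"
          by (rule trans[OF _ q[symmetric]]) (simp add: vn)
        also have "(\<Sum>a\<in>I. v $ a *\<^sub>R w a) = (\<Sum>i\<in>S. s i)"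
          unfolding I_def sum.reindex[OF e] using u by (simp add: ve we)
        finally show ?thesis using z(1) by simp
      qed
      ultimately show "z \<in> f ` C" by blast
    next
      fix z assume "z \<in> f ` C"
      then obtain v where v: "v \<in> C" "z = f v" by blast
      define q where "q = (\<Sum>a\<in>UNIV - I. v $ a *\<^sub>R w a)"
      have "z = q + (\<Sum>a\<in>I. v $ a *\<^sub>R w a)"
        unfolding v fv q_def by (rule sum.subset_diff) auto
      also have "(\<Sum>a\<in>I. v $ a *\<^sub>R w a) = (\<Sum>i\<in>S. v $ e i *\<^sub>R x i)"
        unfolding I_def sum.reindex[OF e] by (simp add: we)
      finally have z: "z = q + (\<Sum>i\<in>S. v $ e i *\<^sub>R x i)" .
      have "(norm q)\<^sup>2 \<le> t\<^sup>2" unfolding q_def norm_sum using v by (simp add: C_iff)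
      then have "norm q \<le> t" using t by (simp add: power2_le_iff_abs_le)
      moreover have "q \<bullet> x i = 0" if "i \<in> S" for i
        unfolding q_def we[OF that, symmetric] orth_sum using that by (simp add: I_def)
      ultimately have "q \<in> Q" by (simp add: Q_def)
      moreover have "v $ e i *\<^sub>R x i \<in> seg (x i)" if "i \<in> S" for i
        using v(1) that unfolding C_iff by (auto simp: closed_segment_def)
      then have "(\<Sum>i\<in>S. v $ e i *\<^sub>R x i) \<in> (\<Sum>i\<in>S. seg (x i))"
        unfolding set_sum_alt[OF S] by blast
      ultimately show "z \<in> Q + (\<Sum>i\<in>S. seg (x i))" unfolding z by auto
    qed
    have card_I: "card ((\<lambda>a::'d. axis a (1::real)) ` I) = card S"
      using card_image[OF e] card_image[OF inj_axis] by (simp add: I_def)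
    have C: "emeasure lborel C =
        ennreal (unit_ball_vol (real (CARD('d) - card S)) * t ^ (CARD('d) - card S))"
    proof -
      have "(\<lambda>a::'d. axis a (1::real)) ` I \<subseteq> Basis" by (auto simp: axis_in_Basis_iff)
      from emeasure_cylinder[OF this t] show ?thesis
        unfolding C_def[symmetric] card_I by simp
    qed
    have "closed C"
      unfolding C_def Collect_conj_eq Collect_ball_eq
      by (intro closed_Int closed_INT ballI closed_Collect_le continuous_intros)
    then have "C \<in> sets lborel" by simp
    then have "emeasure lebesgue C = emeasure lborel C" by simp
    with C have meas: "measure lebesgue C = unit_ball_vol (real (CARD('d) - card S)) * t ^ (CARD('d) - card S)"
      using t by (simp add: measure_def)
    have "C \<in> lmeasurable"
      using C \<open>C \<in> sets lborel\<close> \<open>emeasure lebesgue C = _\<close> by (intro fmeasurableI) auto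
    have "mixed_diff S x (measure lebesgue) (cball 0 t) = mixed_diff S x (measure lebesgue) Q"
      unfolding Q_def using t by (intro mixed_diff_cball seg_affine_measure S) simp
    also have "\<dots> = measure lebesgue (f ` C)"
      unfolding image[symmetric] using body lower S
      by (intro mixed_diff_eq_top seg_affine_measure) auto
    also have "\<dots> = \<bar>det A\<bar> * measure lebesgue C"
      using measure_linear_image_cart[OF f \<open>C \<in> lmeasurable\<close>] by (simp add: det_f)
    finally show ?thesis using True gram meas by simp
  qed
qed

text \<open>The expansion over subsets, grouped by cardinality. The \<open>k\<close>-th intrinsic
  volume of a zonotope thus appears as the sum of the \<open>k\<close>-volumes of the parallelotopes
  spanned by \<open>k\<close> of its generators.\<close>

lemma measure_cball_plus_zonotope:
  fixes x :: "'i \<Rightarrow> real^'d"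
  assumes I: "finite I" and t: "0 < t"
  shows "measure lebesgue (cball 0 t + (\<Sum>i\<in>I. seg (x i))) =
    (\<Sum>k\<le>CARD('d). t ^ (CARD('d) - k) * unit_ball_vol (real (CARD('d) - k)) *
      (\<Sum>S | S \<subseteq> I \<and> card S = k. sqrt (gram_det S x)))"
proof -
  let ?g = "\<lambda>k S. t ^ (CARD('d) - k) * unit_ball_vol (real (CARD('d) - k)) * sqrt (gram_det S x)"
  have "measure lebesgue (cball 0 t + (\<Sum>i\<in>I. seg (x i))) =
      (\<Sum>S\<in>Pow I. if card S \<le> CARD('d) then ?g (card S) S else 0)"
    unfolding mixed_diff_expansion[OF I]
    using I finite_subset t by (intro sum.cong refl mixed_diff_measure_cball) auto
  also have "\<dots> = (\<Sum>S\<in>{S \<in> Pow I. card S \<le> CARD('d)}. ?g (card S) S)"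
    using I by (intro sum.inter_filter[symmetric]) simp
  also have "\<dots> = (\<Sum>k\<le>CARD('d). \<Sum>S | S \<in> {S \<in> Pow I. card S \<le> CARD('d)} \<and> card S = k. ?g (card S) S)"
    using I by (intro sum.group[symmetric]) auto
  also have "\<dots> = (\<Sum>k\<le>CARD('d). \<Sum>S | S \<subseteq> I \<and> card S = k. ?g k S)"
    by (intro sum.cong refl) auto
  finally show ?thesis by (simp add: sum_distrib_left mult.assoc)
qed

subsection \<open>Random zonotopes\<close>

text \<open>Composition with the transposition of \<open>i\<close> and \<open>j\<close> reverses all
  signs but preserves all products, so the determinant equals its own negative.\<close>

lemma gram_det_repeated:
  assumes S: "finite S" and ij: "i \<in> S" "j \<in> S" "i \<noteq> j" "x i = x j"
  shows "gram_det S x = 0"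
proof -
  let ?q = "Transposition.transpose i j"
  have q: "?q permutes S" using ij by (intro permutes_swap_id)
  have xq: "x (?q a) = x a" for a using ij by (simp add: Transposition.transpose_def)
  have "gram_det S x = (\<Sum>p | p permutes S. of_int (sign (?q \<circ> p)) * (\<Prod>a\<in>S. x a \<bullet> x ((?q \<circ> p) a)))"
    unfolding gram_det_def by (rule setum_permutations_compose_left[OF q])
  also have "\<dots> = (\<Sum>p | p permutes S. - (of_int (sign p) * (\<Prod>a\<in>S. x a \<bullet> x (p a))))"
  proof (intro sum.cong refl)
    fix p assume "p \<in> {p. p permutes S}"
    then have "sign (?q \<circ> p) = - sign p"
      using S ij q by (subst sign_compose) (auto simp: permutation_permutes sign_swap_id)
    then show "of_int (sign (?q \<circ> p)) * (\<Prod>a\<in>S. x a \<bullet> x ((?q \<circ> p) a)) =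
        - (of_int (sign p) * (\<Prod>a\<in>S. x a \<bullet> x (p a)))"
      by (simp add: xq)
  qed
  also have "\<dots> = - gram_det S x" by (simp add: gram_det_def sum_negf)
  finally show ?thesis by simp
qed

lemma gram_det_scaleR: "finite S \<Longrightarrow> gram_det S (\<lambda>i. c i *\<^sub>R x i) = (\<Prod>i\<in>S. c i)\<^sup>2 * gram_det S x"
  unfolding gram_det_def sum_distrib_left
proof (intro sum.cong refl)
  fix p assume "finite S" "p \<in> {p. p permutes S}"
  then have "(\<Prod>i\<in>S. c (p i)) = (\<Prod>i\<in>S. c i)"
    using prod.permute[of p S c] by (simp add: o_def)
  then show "of_int (sign p) * (\<Prod>i\<in>S. c i *\<^sub>R x i \<bullet> c (p i) *\<^sub>R x (p i)) =
      (\<Prod>i\<in>S. c i)\<^sup>2 * (of_int (sign p) * (\<Prod>i\<in>S. x i \<bullet> x (p i)))"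
    by (simp add: prod.distrib power2_eq_square)
qed

text \<open>Cauchy-Schwarz in each Leibniz term; the factorial counts the permutations. Hadamard's
  inequality would give constant 1, but the bound serves only as an integrable majorant.\<close>

lemma abs_gram_det_le:
  assumes S: "finite S"
  shows "\<bar>gram_det S x\<bar> \<le> fact (card S) * (\<Prod>i\<in>S. norm (x i))\<^sup>2"
proof -
  have "\<bar>gram_det S x\<bar> \<le> (\<Sum>p | p permutes S. (\<Prod>i\<in>S. norm (x i))\<^sup>2)"
    unfolding gram_det_def
  proof (rule order_trans[OF sum_abs], rule sum_mono)
    fix p assume p: "p \<in> {p. p permutes S}"
    have "\<bar>of_int (sign p) * (\<Prod>i\<in>S. x i \<bullet> x (p i))\<bar> = (\<Prod>i\<in>S. \<bar>x i \<bullet> x (p i)\<bar>)"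
      by (simp add: abs_mult abs_prod sign_def)
    also have "\<dots> \<le> (\<Prod>i\<in>S. norm (x i) * norm (x (p i)))"
      by (intro prod_mono) (auto simp: Cauchy_Schwarz_ineq2)
    also have "\<dots> = (\<Prod>i\<in>S. norm (x i))\<^sup>2"
      using p prod.permute[of p S "\<lambda>i. norm (x i)"] by (simp add: prod.distrib o_def power2_eq_square)
    finally show "\<bar>of_int (sign p) * (\<Prod>i\<in>S. x i \<bullet> x (p i))\<bar> \<le> (\<Prod>i\<in>S. norm (x i))\<^sup>2" .
  qed
  also have "\<dots> = fact (card S) * (\<Prod>i\<in>S. norm (x i))\<^sup>2"
    using S by (simp add: card_permutations)
  finally show ?thesis .
qed

lemma abs_sqrt_gram_det_le:
  assumes "finite S"
  shows "\<bar>sqrt (gram_det S x)\<bar> \<le> sqrt (fact (card S)) * (\<Prod>i\<in>S. norm (x i))"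
proof -
  \<comment> \<open>\<open>sqrt\<close> extends to negative reals as an odd function, so the sign of
    the Gram determinant does not matter here.\<close>
  have "\<bar>sqrt (gram_det S x)\<bar> = sqrt \<bar>gram_det S x\<bar>"
    by (auto simp: abs_if real_sqrt_minus)
  also have "\<dots> \<le> sqrt (fact (card S) * (\<Prod>i\<in>S. norm (x i))\<^sup>2)"
    using abs_gram_det_le[OF assms] by (rule real_sqrt_le_mono)
  also have "\<dots> = sqrt (fact (card S)) * (\<Prod>i\<in>S. norm (x i))"
    by (simp add: real_sqrt_mult prod_nonneg)
  finally show ?thesis .
qed

text \<open>Each \<open>k\<close>-subset is the image of exactly \<open>k!\<close> injections from
  \<open>{..<k}\<close>, and on these the summand depends on the image alone.\<close>

lemma sum_PiE_inj_on:
  fixes h :: "(nat \<Rightarrow> 'a) \<Rightarrow> real"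
  assumes Y: "finite Y"
    and not_inj: "\<And>f. f \<in> {..<k} \<rightarrow>\<^sub>E Y \<Longrightarrow> \<not> inj_on f {..<k} \<Longrightarrow> h f = 0"
    and inj: "\<And>f. f \<in> {..<k} \<rightarrow>\<^sub>E Y \<Longrightarrow> inj_on f {..<k} \<Longrightarrow> h f = H (f ` {..<k})"
  shows "(\<Sum>f\<in>{..<k} \<rightarrow>\<^sub>E Y. h f) = fact k * (\<Sum>S | S \<subseteq> Y \<and> card S = k. H S)"
proof -
  let ?F = "{f \<in> {..<k} \<rightarrow>\<^sub>E Y. inj_on f {..<k}}" and ?T = "{S. S \<subseteq> Y \<and> card S = k}"
  have finPi: "finite ({..<k} \<rightarrow>\<^sub>E Y)" using Y by (intro finite_PiE) auto
  have finT: "finite ?T" using Y by (intro finite_subset[of ?T "Pow Y"]) auto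
  have "(\<Sum>f\<in>{..<k} \<rightarrow>\<^sub>E Y. h f) = (\<Sum>f\<in>?F. H (f ` {..<k}))"
  proof (rule sum.mono_neutral_cong_right[OF finPi])
    show "\<forall>f\<in>({..<k} \<rightarrow>\<^sub>E Y) - ?F. h f = 0" using not_inj by blast
    show "h f = H (f ` {..<k})" if "f \<in> ?F" for f using inj that by blast
  qed blast
  also have "\<dots> = (\<Sum>S\<in>?T. \<Sum>f | f \<in> ?F \<and> f ` {..<k} = S. H (f ` {..<k}))"
  proof (rule sum.group[symmetric, where g = "\<lambda>f. f ` {..<k}"])
    show "(\<lambda>f. f ` {..<k}) ` ?F \<subseteq> ?T"
    proof (rule image_subsetI)
      fix f assume "f \<in> ?F"
      then show "f ` {..<k} \<in> ?T" by (auto simp: card_image dest: PiE_mem)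
    qed
  qed (use finPi finT in auto)
  also have "\<dots> = (\<Sum>S\<in>?T. fact k * H S)"
  proof (rule sum.cong[OF refl])
    fix S assume S: "S \<in> ?T"
    then have "finite S" using Y finite_subset by auto
    have "{f. f \<in> ?F \<and> f ` {..<k} = S} = {f \<in> {..<k} \<rightarrow>\<^sub>E S. inj_on f {..<k}}"
    proof (intro subset_antisym subsetI)
      fix f assume f: "f \<in> {f \<in> {..<k} \<rightarrow>\<^sub>E S. inj_on f {..<k}}"
      then have "f ` {..<k} \<subseteq> S" by (auto dest: PiE_mem)
      moreover have "card (f ` {..<k}) = card S" using f S by (simp add: card_image)
      ultimately have "f ` {..<k} = S" using \<open>finite S\<close> by (intro card_subset_eq)
      moreover have "f \<in> {..<k} \<rightarrow>\<^sub>E Y" using f S PiE_mono[of "{..<k}" "\<lambda>_. S" "\<lambda>_. Y"] by blast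
      ultimately show "f \<in> {f. f \<in> ?F \<and> f ` {..<k} = S}" using f by simp
    next
      fix f assume "f \<in> {f. f \<in> ?F \<and> f ` {..<k} = S}"
      then have f: "f \<in> extensional {..<k}" "f ` {..<k} = S" "inj_on f {..<k}"
        by (simp_all add: PiE_iff)
      then show "f \<in> {f \<in> {..<k} \<rightarrow>\<^sub>E S. inj_on f {..<k}}"
        by (simp add: PiE_iff) blast
    qed
    then have "card {f. f \<in> ?F \<and> f ` {..<k} = S} = prod ((-) k) {0..<k}"
      using card_inj_on_subset_funcset[of "{..<k}" S "{..<k}"] \<open>finite S\<close> S by simp
    also have "\<dots> = fact k" by (simp add: fact_prod_rev)
    finally have "real (card {f. f \<in> ?F \<and> f ` {..<k} = S}) = fact k" by simp
    moreover have "(\<Sum>f | f \<in> ?F \<and> f ` {..<k} = S. H (f ` {..<k})) =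
        (\<Sum>f | f \<in> ?F \<and> f ` {..<k} = S. H S)"
      by (intro sum.cong) auto
    ultimately show "(\<Sum>f | f \<in> ?F \<and> f ` {..<k} = S. H (f ` {..<k})) = fact k * H S"
      by simp
  qed
  finally show ?thesis by (simp add: sum_distrib_left)
qed

text \<open>If \<open>p\<close> gives the probabilities of the values in \<open>Y\<close>, the left
  side is a mean over \<open>k\<close> independent draws. Repeated draws contribute 0; otherwise the
  weights are absorbed into the vectors, which become generators of a zonotope.\<close>

lemma sum_PiE_gram_det:
  fixes p :: "'a::real_inner \<Rightarrow> real"
  assumes Y: "finite Y" and p: "\<And>y. y \<in> Y \<Longrightarrow> 0 \<le> p y"
  shows "(\<Sum>f\<in>{..<k} \<rightarrow>\<^sub>E Y. (\<Prod>i<k. p (f i)) * sqrt (gram_det {..<k} f)) =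
    fact k * (\<Sum>S | S \<subseteq> Y \<and> card S = k. sqrt (gram_det S (\<lambda>y. p y *\<^sub>R y)))"
proof (rule sum_PiE_inj_on[OF Y])
  fix f assume f: "f \<in> {..<k} \<rightarrow>\<^sub>E Y"
  show "(\<Prod>i<k. p (f i)) * sqrt (gram_det {..<k} f) = 0" if not_inj: "\<not> inj_on f {..<k}"
  proof -
    obtain i j where "i \<in> {..<k}" "j \<in> {..<k}" "i \<noteq> j" "f i = f j"
      using not_inj by (meson inj_onI)
    then show ?thesis using gram_det_repeated[of "{..<k}" i j f] by simp
  qed
  show "(\<Prod>i<k. p (f i)) * sqrt (gram_det {..<k} f) =
      sqrt (gram_det (f ` {..<k}) (\<lambda>y. p y *\<^sub>R y))" if inj: "inj_on f {..<k}"
  proof -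
    have "gram_det (f ` {..<k}) (\<lambda>y. p y *\<^sub>R y) = (\<Prod>y\<in>f ` {..<k}. p y)\<^sup>2 * gram_det (f ` {..<k}) (\<lambda>y. y)"
      by (rule gram_det_scaleR) simp
    also have "gram_det (f ` {..<k}) (\<lambda>y. y) = gram_det {..<k} f"
      using gram_det_reindex[OF inj, of "\<lambda>y. y"] by (simp add: o_def)
    also have "(\<Prod>y\<in>f ` {..<k}. p y) = (\<Prod>i<k. p (f i))"
      using prod.reindex[OF inj] by simp
    finally have "gram_det (f ` {..<k}) (\<lambda>y. p y *\<^sub>R y) = (\<Prod>i<k. p (f i))\<^sup>2 * gram_det {..<k} f" .
    moreover have "0 \<le> (\<Prod>i<k. p (f i))"
      using f p by (intro prod_nonneg) (auto simp: PiE_iff)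
    ultimately show ?thesis by (simp add: real_sqrt_mult)
  qed
qed

text \<open>\<open>mean_gram \<mu> k \<phi>\<close> is the mean of \<open>sqrt (det (G\<^sup>T G))\<close> for a matrix \<open>G\<close> whose \<open>k\<close> columns are independent
  copies of \<open>\<phi>\<close> under \<open>\<mu>\<close>.\<close>

definition mean_gram :: "'a::euclidean_space measure \<Rightarrow> nat \<Rightarrow> ('a \<Rightarrow> 'a) \<Rightarrow> real" where
  "mean_gram \<mu> k \<phi> = (LINT x|PiM {..<k} (\<lambda>_. \<mu>). sqrt (gram_det {..<k} (\<lambda>i. \<phi> (x i))))"

text \<open>The intersection of the half-spaces prescribed by the expected support function of
  \<open>seg (\<phi> x)\<close>. Taking the intersection gives a set outright; that each bound is
  attained is proved afterwards.\<close>

definition mean_body :: "'w measure \<Rightarrow> ('w \<Rightarrow> 'a::euclidean_space) \<Rightarrow> 'a set" where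
  "mean_body M \<phi> = {z. \<forall>u. z \<bullet> u \<le> (LINT x|M. max 0 (\<phi> x \<bullet> u))}"

section \<open>Mean bodies and their support functions\<close>

lemma integrable_max_inner [simp]:
  "integrable M \<phi> \<Longrightarrow> integrable M (\<lambda>x. max 0 (\<phi> x \<bullet> u))"
  by (intro integrable_max integrable_zero integrable_inner_left) auto

text \<open>The maximiser in direction \<open>u\<close> is the expectation of the extreme selection:
  the endpoint \<open>\<phi> x\<close> of the segment when it points towards \<open>u\<close>, and 0
  otherwise.\<close>

lemma mean_body_attained:
  assumes \<phi>: "integrable M \<phi>"
  shows "\<exists>z\<in>mean_body M \<phi>. z \<bullet> u = (LINT x|M. max 0 (\<phi> x \<bullet> u))"
proof -
  have [measurable]: "\<phi> \<in> borel_measurable M" using \<phi> by simp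
  define \<psi> where "\<psi> x = (if \<phi> x \<bullet> u > 0 then \<phi> x else 0)" for x
  have \<psi>: "integrable M \<psi>"
  proof (rule Bochner_Integration.integrable_bound[OF \<phi>])
    show "\<psi> \<in> borel_measurable M" unfolding \<psi>_def by measurable
  qed (auto simp: \<psi>_def)
  have inner: "integral\<^sup>L M \<psi> \<bullet> v = (LINT x|M. \<psi> x \<bullet> v)" for v
    using \<psi> by simp
  have "integral\<^sup>L M \<psi> \<bullet> v \<le> (LINT x|M. max 0 (\<phi> x \<bullet> v))" for v
    unfolding inner
  proof (rule integral_mono)
    show "integrable M (\<lambda>x. \<psi> x \<bullet> v)" using \<psi> by simp
  qed (use \<phi> in \<open>auto simp: \<psi>_def\<close>)
  moreover have "integral\<^sup>L M \<psi> \<bullet> u = (LINT x|M. max 0 (\<phi> x \<bullet> u))"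
    unfolding inner by (intro Bochner_Integration.integral_cong) (auto simp: \<psi>_def)
  ultimately show ?thesis by (auto simp: mean_body_def)
qed

lemma convex_body_mean_body:
  assumes \<phi>: "integrable M \<phi>"
  shows "convex_body (mean_body M \<phi>)"
proof -
  let ?h = "\<lambda>u. LINT x|M. max 0 (\<phi> x \<bullet> u)"
  have eq: "mean_body M \<phi> = (\<Inter>u. {z. u \<bullet> z \<le> ?h u})"
    by (auto simp: mean_body_def inner_commute)
  have "closed (mean_body M \<phi>)" "convex (mean_body M \<phi>)"
    unfolding eq by (auto intro!: closed_INT closed_halfspace_le convex_INT convex_halfspace_le)
  moreover have "bounded (mean_body M \<phi>)"
    unfolding bounded_iff
  proof (intro exI ballI)
    fix z assume z: "z \<in> mean_body M \<phi>"
    have "norm z \<le> (\<Sum>b\<in>Basis. \<bar>z \<bullet> b\<bar>)" by (rule norm_le_l1)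
    also have "\<dots> \<le> (\<Sum>b\<in>Basis. max (?h b) (?h (- b)))"
    proof (rule sum_mono)
      fix b :: 'b
      have "z \<bullet> b \<le> ?h b" "z \<bullet> (- b) \<le> ?h (- b)"
        using z by (auto simp: mean_body_def simp del: inner_minus_right)
      then show "\<bar>z \<bullet> b\<bar> \<le> max (?h b) (?h (- b))" by auto
    qed
    finally show "norm z \<le> (\<Sum>b\<in>Basis. max (?h b) (?h (- b)))" .
  qed
  moreover have "mean_body M \<phi> \<noteq> {}" using mean_body_attained[OF \<phi>] by auto
  ultimately show ?thesis by (simp add: convex_body_def compact_eq_bounded_closed)
qed

lemma support_function_mean_body:
  assumes \<phi>: "integrable M \<phi>"
  shows "support_function (mean_body M \<phi>) u = (LINT x|M. max 0 (\<phi> x \<bullet> u))"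
  unfolding support_function_def
proof (rule cSup_eq_maximum)
  show "(LINT x|M. max 0 (\<phi> x \<bullet> u)) \<in> (\<lambda>x. x \<bullet> u) ` mean_body M \<phi>"
    using mean_body_attained[OF \<phi>, of u] by (metis imageI)
qed (auto simp: mean_body_def)

lemma support_function_seg: "support_function (seg x) u = max 0 (x \<bullet> u)"
  unfolding support_function_def
proof (rule cSup_eq_maximum)
  show "max 0 (x \<bullet> u) \<in> (\<lambda>y. y \<bullet> u) ` seg x"
    by (cases "x \<bullet> u \<ge> 0") (auto intro!: image_eqI[of _ _ x] image_eqI[of _ _ 0])
  fix y assume "y \<in> (\<lambda>y. y \<bullet> u) ` seg x"
  then obtain c where "0 \<le> c" "c \<le> 1" "y = c * (x \<bullet> u)" by (auto simp: closed_segment_def)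
  then show "y \<le> max 0 (x \<bullet> u)"
    by (cases "x \<bullet> u \<ge> 0") (auto simp: mult_left_le_one_le mult_nonneg_nonpos)
qed

lemma selection_expectation_seg:
  assumes "integrable M \<xi>"
  shows "selection_expectation M (\<lambda>\<omega>. seg (\<xi> \<omega>)) = mean_body M \<xi>"
  by (rule selection_expectation_eqI)
    (simp_all add: assms convex_body_mean_body support_function_mean_body support_function_seg)

text \<open>A hyperplane separating \<open>z\<close> from the neighbourhood would violate the bound
  in the direction opposite to its normal. With \<open>r = 0\<close> this is the membership
  criterion for \<open>L\<close> itself.\<close>

lemma mem_plus_cball_of_support:
  fixes L :: "'a::euclidean_space set"
  assumes L: "convex_body L" and H: "\<And>u. \<exists>x\<in>L. H u \<le> x \<bullet> u"
    and z: "\<And>u. z \<bullet> u \<le> H u + r * norm u" and r: "0 \<le> r"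
  shows "z \<in> L + cball 0 r"
proof (rule ccontr)
  assume "z \<notin> L + cball 0 r"
  moreover have "convex_body (L + cball 0 r)" using L r by (intro convex_body_set_plus) auto
  ultimately obtain a b where ab: "a \<bullet> z < b" "\<And>x. x \<in> L + cball 0 r \<Longrightarrow> a \<bullet> x > b"
    using separating_hyperplane_closed_point[of "L + cball 0 r" z]
    by (auto simp: convex_body_def compact_imp_closed)
  obtain x where x: "x \<in> L" "H (- a) \<le> x \<bullet> (- a)" using H by blast
  \<comment> \<open>The point of the ball of radius \<open>r\<close> about \<open>x\<close> that
    lies farthest against \<open>a\<close>. For \<open>a = 0\<close> division by zero gives
    \<open>y = x\<close>, and the computation still holds.\<close>
  define y where "y = x - (r / norm a) *\<^sub>R a"
  have "y \<in> L + cball 0 r"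
  proof -
    have "- ((r / norm a) *\<^sub>R a) \<in> cball 0 r" using r by simp
    then have "x + - ((r / norm a) *\<^sub>R a) \<in> L + cball 0 r" by (rule set_plus_intro[OF x(1)])
    then show ?thesis by (simp add: y_def)
  qed
  then have "a \<bullet> y > b" by (rule ab)
  moreover have "a \<bullet> y = a \<bullet> x - r * norm a"
    by (simp add: y_def inner_diff_right dot_square_norm power2_eq_square)
  moreover have "z \<bullet> (- a) \<le> x \<bullet> (- a) + r * norm a"
    using z[of "- a"] x(2) by simp
  ultimately show False using ab(1) by (simp add: inner_commute)
qed

text \<open>Since \<open>max 0\<close> is 1-Lipschitz, the two support functions differ at
  \<open>u\<close> by at most the \<open>L\<^sup>1\<close>-distance times
  \<open>norm u\<close>.\<close>

lemma mean_body_subset: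
  assumes \<phi>: "integrable M \<phi>" and \<psi>: "integrable M \<psi>"
  shows "mean_body M \<phi> \<subseteq> mean_body M \<psi> + cball 0 (LINT x|M. norm (\<phi> x - \<psi> x))"
proof
  fix z assume z: "z \<in> mean_body M \<phi>"
  show "z \<in> mean_body M \<psi> + cball 0 (LINT x|M. norm (\<phi> x - \<psi> x))"
  proof (rule mem_plus_cball_of_support[OF convex_body_mean_body[OF \<psi>]])
    show "\<exists>x\<in>mean_body M \<psi>. (LINT x|M. max 0 (\<psi> x \<bullet> u)) \<le> x \<bullet> u" for u
      using mean_body_attained[OF \<psi>, of u] by (metis order_refl)
    fix u
    have "max 0 (\<phi> x \<bullet> u) \<le> max 0 (\<psi> x \<bullet> u) + norm (\<phi> x - \<psi> x) * norm u" for x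
      using norm_cauchy_schwarz[of "\<phi> x - \<psi> x" u] by (auto simp: inner_diff_left max_def)
    then have "(LINT x|M. max 0 (\<phi> x \<bullet> u)) \<le>
        (LINT x|M. max 0 (\<psi> x \<bullet> u) + norm (\<phi> x - \<psi> x) * norm u)"
      using \<phi> \<psi> by (intro integral_mono) auto
    also have "\<dots> = (LINT x|M. max 0 (\<psi> x \<bullet> u)) + (LINT x|M. norm (\<phi> x - \<psi> x)) * norm u"
      using \<phi> \<psi> by (subst Bochner_Integration.integral_add) auto
    finally show "z \<bullet> u \<le> (LINT x|M. max 0 (\<psi> x \<bullet> u)) + (LINT x|M. norm (\<phi> x - \<psi> x)) * norm u"
      using z by (auto simp: mean_body_def intro: order_trans)
  qed simp
qed

section \<open>Simple random vectors and zonotopes\<close>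

lemma integral_finite_range:
  fixes F :: "'b \<Rightarrow> 'c::euclidean_space"
  assumes "prob_space M" and \<phi>: "simple_function M \<phi>"
  shows "(LINT x|M. F (\<phi> x)) =
    (\<Sum>y\<in>\<phi> ` space M. measure M (\<phi> -` {y} \<inter> space M) *\<^sub>R F y)"
proof -
  interpret prob_space M by fact
  have fin: "finite (\<phi> ` space M)" using \<phi> by (simp add: simple_function_def)
  have sets: "\<phi> -` {y} \<inter> space M \<in> sets M" for y
    using \<phi> by (rule simple_functionD(2))
  have "(LINT x|M. F (\<phi> x)) = (LINT x|M. (\<Sum>y\<in>\<phi> ` space M. indicator (\<phi> -` {y} \<inter> space M) x *\<^sub>R F y))"
  proof (rule Bochner_Integration.integral_cong[OF refl])
    fix x assume x: "x \<in> space M"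
    have "(\<Sum>y\<in>\<phi> ` space M. indicat_real (\<phi> -` {y} \<inter> space M) x *\<^sub>R F y) =
        (\<Sum>y\<in>\<phi> ` space M. if y = \<phi> x then F y else 0)"
      using x by (intro sum.cong) (auto simp: indicator_def)
    then show "F (\<phi> x) = (\<Sum>y\<in>\<phi> ` space M. indicat_real (\<phi> -` {y} \<inter> space M) x *\<^sub>R F y)"
      using x fin by simp
  qed
  also have "\<dots> = (\<Sum>y\<in>\<phi> ` space M. measure M (\<phi> -` {y} \<inter> space M) *\<^sub>R F y)"
    using sets by (subst Bochner_Integration.integral_sum) (auto simp: less_top[symmetric])
  finally show ?thesis .
qed

lemma mean_body_simple_function:
  fixes \<phi> :: "'w \<Rightarrow> 'a::euclidean_space"
  assumes M: "prob_space M" and \<phi>: "simple_function M \<phi>" "integrable M \<phi>"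
  shows "mean_body M \<phi> = (\<Sum>y\<in>\<phi> ` space M. seg (measure M (\<phi> -` {y} \<inter> space M) *\<^sub>R y))"
    (is "_ = ?Z")
proof -
  let ?Y = "\<phi> ` space M" and ?p = "\<lambda>y. measure M (\<phi> -` {y} \<inter> space M)"
  have fin: "finite ?Y" using \<phi> by (simp add: simple_function_def)
  have h: "(LINT x|M. max 0 (\<phi> x \<bullet> u)) = (\<Sum>y\<in>?Y. ?p y * max 0 (y \<bullet> u))" for u
    using integral_finite_range[OF M \<phi>(1), of "\<lambda>y. max 0 (y \<bullet> u)"] by simp
  show ?thesis
  proof (intro subset_antisym subsetI)
    fix z assume z: "z \<in> mean_body M \<phi>"
    have "z \<in> ?Z + cball 0 0"
    proof (rule mem_plus_cball_of_support)
      show "convex_body ?Z" by (intro convex_body_sum) simp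
      show "\<exists>x\<in>?Z. (LINT x|M. max 0 (\<phi> x \<bullet> u)) \<le> x \<bullet> u" for u
      proof
        \<comment> \<open>A point of the zonotope extreme in direction \<open>u\<close>: the far end
          of each generator with positive inner product, the origin of every other one.\<close>
        let ?x = "\<Sum>y\<in>?Y. if y \<bullet> u > 0 then ?p y *\<^sub>R y else 0"
        show "?x \<in> ?Z" unfolding set_sum_alt[OF fin] by auto
        show "(LINT x|M. max 0 (\<phi> x \<bullet> u)) \<le> ?x \<bullet> u"
          unfolding h inner_sum_left by (intro sum_mono) auto
      qed
      show "z \<bullet> u \<le> (LINT x|M. max 0 (\<phi> x \<bullet> u)) + 0 * norm u" for u
        using z by (simp add: mean_body_def)
    qed simp
    then show "z \<in> ?Z" by (simp add: set_zero)
  next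
    fix z assume "z \<in> ?Z"
    then obtain s where s: "z = sum s ?Y" "\<And>y. y \<in> ?Y \<Longrightarrow> s y \<in> seg (?p y *\<^sub>R y)"
      unfolding set_sum_alt[OF fin] by auto
    have "z \<bullet> u \<le> (\<Sum>y\<in>?Y. ?p y * max 0 (y \<bullet> u))" for u
      unfolding s(1) inner_sum_left
    proof (rule sum_mono)
      fix y assume "y \<in> ?Y"
      then obtain c where c: "0 \<le> c" "c \<le> 1" "s y = c *\<^sub>R ?p y *\<^sub>R y"
        using s(2)[of y] by (auto simp: closed_segment_def)
      have "c * (y \<bullet> u) \<le> max 0 (y \<bullet> u)"
        using c by (cases "y \<bullet> u \<ge> 0") (auto simp: mult_left_le_one_le mult_nonneg_nonpos)
      then show "s y \<bullet> u \<le> ?p y * max 0 (y \<bullet> u)"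
        using c(3) mult_left_mono[of "c * (y \<bullet> u)" "max 0 (y \<bullet> u)" "?p y"] by (simp add: ac_simps)
    qed
    then show "z \<in> mean_body M \<phi>" by (simp add: mean_body_def h)
  qed
qed

text \<open>The boxes \<open>B f\<close> partition the product space, the integrand is constant on
  each, and the measure of a box is a product of probabilities.\<close>

lemma mean_gram_simple_function:
  fixes \<mu> :: "'a::euclidean_space measure"
  assumes M: "prob_space \<mu>" and \<phi>: "simple_function \<mu> \<phi>"
  shows "mean_gram \<mu> k \<phi> = (\<Sum>f\<in>{..<k} \<rightarrow>\<^sub>E \<phi> ` space \<mu>.
    (\<Prod>i<k. measure \<mu> (\<phi> -` {f i} \<inter> space \<mu>)) * sqrt (gram_det {..<k} f))"
proof -
  interpret prob_space \<mu> by fact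
  interpret P: finite_product_prob_space "\<lambda>_. \<mu>" "{..<k}"
    by unfold_locales simp
  let ?Y = "\<phi> ` space \<mu>" and ?G = "\<lambda>f. sqrt (gram_det {..<k} f)"
  let ?P = "PiM {..<k} (\<lambda>_. \<mu>)"
  define B where "B f = (\<Pi>\<^sub>E i\<in>{..<k}. \<phi> -` {f i} \<inter> space \<mu>)" for f
  have sets: "\<phi> -` {y} \<inter> space \<mu> \<in> sets \<mu>" for y
    using \<phi> by (rule simple_functionD(2))
  have fin: "finite ({..<k} \<rightarrow>\<^sub>E ?Y)"
    using \<phi> by (intro finite_PiE) (auto simp: simple_function_def)
  have B: "B f \<in> sets ?P" "measure ?P (B f) = (\<Prod>i<k. measure \<mu> (\<phi> -` {f i} \<inter> space \<mu>))" for f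
    unfolding B_def using sets by (auto intro!: sets_PiM_I_finite P.prob_times)
  have "mean_gram \<mu> k \<phi> = (LINT x|?P. (\<Sum>f\<in>{..<k} \<rightarrow>\<^sub>E ?Y. indicator (B f) x * ?G f))"
    unfolding mean_gram_def
  proof (rule Bochner_Integration.integral_cong[OF refl])
    fix x assume x: "x \<in> space ?P"
    define g where "g = (\<lambda>i\<in>{..<k}. \<phi> (x i))"
    have xi: "x i \<in> space \<mu>" if "i < k" for i using x that by (auto simp: space_PiM)
    have g: "g \<in> {..<k} \<rightarrow>\<^sub>E ?Y" using xi by (auto simp: g_def)
    have "x \<in> B f \<longleftrightarrow> f = g" if f: "f \<in> {..<k} \<rightarrow>\<^sub>E ?Y" for f
    proof
      assume "x \<in> B f"
      then have "f i = g i" if "i < k" for i using that by (auto simp: B_def g_def PiE_iff)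
      then show "f = g" using f g by (intro PiE_ext[of f]) auto
    next
      assume "f = g"
      then show "x \<in> B f" using x xi by (auto simp: B_def g_def space_PiM PiE_iff)
    qed
    then have "(\<Sum>f\<in>{..<k} \<rightarrow>\<^sub>E ?Y. indicator (B f) x * ?G f) =
        (\<Sum>f\<in>{..<k} \<rightarrow>\<^sub>E ?Y. if f = g then ?G f else 0)"
      by (intro sum.cong) (auto simp: indicator_def)
    also have "\<dots> = ?G g" using fin g by simp
    also have "\<dots> = sqrt (gram_det {..<k} (\<lambda>i. \<phi> (x i)))"
      by (intro arg_cong[of _ _ sqrt] gram_det_cong) (simp add: g_def)
    finally show "sqrt (gram_det {..<k} (\<lambda>i. \<phi> (x i))) =
        (\<Sum>f\<in>{..<k} \<rightarrow>\<^sub>E ?Y. indicator (B f) x * ?G f)" by simp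
  qed
  also have "\<dots> = (\<Sum>f\<in>{..<k} \<rightarrow>\<^sub>E ?Y. measure ?P (B f) * ?G f)"
    using B(1) by (subst Bochner_Integration.integral_sum) (auto simp: less_top[symmetric])
  finally show ?thesis unfolding B(2) .
qed

subsection \<open>The Steiner formula of a mean body\<close>

definition mean_steiner :: "(real^'d) measure \<Rightarrow> (real^'d \<Rightarrow> real^'d) \<Rightarrow> real \<Rightarrow> real" where
  "mean_steiner \<mu> \<phi> t = (\<Sum>k\<le>CARD('d). t ^ (CARD('d) - k) *
     unit_ball_vol (real (CARD('d) - k)) * (mean_gram \<mu> k \<phi> / fact k))"

lemma measure_mean_body_simple_function:
  fixes \<mu> :: "(real^'d) measure"
  assumes M: "prob_space \<mu>" and \<phi>: "simple_function \<mu> \<phi>" "integrable \<mu> \<phi>" and t: "0 < t"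
  shows "measure lebesgue (mean_body \<mu> \<phi> + cball 0 t) = mean_steiner \<mu> \<phi> t"
proof -
  let ?Y = "\<phi> ` space \<mu>" and ?p = "\<lambda>y. measure \<mu> (\<phi> -` {y} \<inter> space \<mu>)"
  have fin: "finite ?Y" using \<phi> by (simp add: simple_function_def)
  have "mean_gram \<mu> k \<phi> / fact k = (\<Sum>S | S \<subseteq> ?Y \<and> card S = k. sqrt (gram_det S (\<lambda>y. ?p y *\<^sub>R y)))" for k
    using sum_PiE_gram_det[OF fin, of ?p k] by (simp add: mean_gram_simple_function[OF M \<phi>(1)])
  then show ?thesis
    unfolding mean_steiner_def mean_body_simple_function[OF M \<phi>]
    by (simp add: add.commute[of _ "cball 0 t"] measure_cball_plus_zonotope[OF fin t])
qed

text \<open>Dominated convergence with a majorant that is a product of functions of single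
  coordinates, hence integrable over the product measure by the first moment alone.\<close>

lemma tendsto_mean_gram:
  fixes \<mu> :: "'a::euclidean_space measure"
  assumes M: "prob_space \<mu>" and sets: "sets \<mu> = sets borel" and int: "integrable \<mu> (\<lambda>x. x)"
    and meas: "\<And>n. \<phi> n \<in> borel_measurable \<mu>" and lim: "\<And>x. (\<lambda>n. \<phi> n x) \<longlonglongrightarrow> x"
    and bound: "\<And>n x. norm (\<phi> n x) \<le> 2 * norm x"
  shows "(\<lambda>n. mean_gram \<mu> k (\<phi> n)) \<longlonglongrightarrow> mean_gram \<mu> k (\<lambda>x. x)"
  unfolding mean_gram_def
proof (rule integral_dominated_convergence)
  interpret prob_space \<mu> by fact
  interpret P: product_sigma_finite "\<lambda>_::nat. \<mu>" ..
  let ?P = "PiM {..<k} (\<lambda>_. \<mu>)"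
  have gram_meas: "(\<lambda>x. sqrt (gram_det {..<k} (\<lambda>i. \<psi> (x i)))) \<in> borel_measurable ?P"
    if \<psi>: "\<psi> \<in> borel_measurable \<mu>" for \<psi> :: "'a \<Rightarrow> 'a"
  proof -
    have coord: "(\<lambda>x. \<psi> (x i)) \<in> borel_measurable ?P" if "i < k" for i
      using measurable_compose[OF measurable_component_singleton[of i "{..<k}" "\<lambda>_. \<mu>"] \<psi>] that by simp
    have "(\<lambda>x. gram_det {..<k} (\<lambda>i. \<psi> (x i))) \<in> borel_measurable ?P"
      unfolding gram_det_def
      by (intro borel_measurable_sum borel_measurable_times borel_measurable_const
          borel_measurable_prod borel_measurable_inner coord)
        (use permutes_in_image[of _ "{..<k}"] in auto)
    then show ?thesis by simp
  qed
  show "(\<lambda>x. sqrt (gram_det {..<k} (\<lambda>i. \<phi> n (x i)))) \<in> borel_measurable ?P" for n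
    by (rule gram_meas[OF meas])
  show "(\<lambda>x. sqrt (gram_det {..<k} (\<lambda>i. x i))) \<in> borel_measurable ?P"
    by (rule gram_meas) (use sets in \<open>simp add: measurable_ident_sets\<close>)
  have "integrable ?P (\<lambda>x. \<Prod>i<k. 2 * norm (x i))"
    using int by (intro P.product_integrable_prod) auto
  then show "integrable ?P (\<lambda>x. sqrt (fact k) * (\<Prod>i<k. 2 * norm (x i)))"
    by simp
  show "AE x in ?P. (\<lambda>n. sqrt (gram_det {..<k} (\<lambda>i. \<phi> n (x i)))) \<longlonglongrightarrow> sqrt (gram_det {..<k} (\<lambda>i. x i))"
    unfolding gram_det_def
    by (intro AE_I2 tendsto_real_sqrt tendsto_sum tendsto_mult tendsto_const tendsto_prod
        tendsto_inner lim)
  show "AE x in ?P. norm (sqrt (gram_det {..<k} (\<lambda>i. \<phi> n (x i)))) \<le> sqrt (fact k) * (\<Prod>i<k. 2 * norm (x i))" for n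
  proof (rule AE_I2)
    fix x
    have "norm (sqrt (gram_det {..<k} (\<lambda>i. \<phi> n (x i)))) \<le> sqrt (fact k) * (\<Prod>i<k. norm (\<phi> n (x i)))"
      using abs_sqrt_gram_det_le[of "{..<k}" "\<lambda>i. \<phi> n (x i)"] by simp
    also have "\<dots> \<le> sqrt (fact k) * (\<Prod>i<k. 2 * norm (x i))"
      by (intro mult_left_mono prod_mono) (auto simp: bound)
    finally show "norm (sqrt (gram_det {..<k} (\<lambda>i. \<phi> n (x i)))) \<le> sqrt (fact k) * (\<Prod>i<k. 2 * norm (x i))" .
  qed
qed

lemma cball_plus_cball:
  assumes "0 \<le> r" "0 \<le> s"
  shows "cball 0 r + cball (0::'a::euclidean_space) s \<subseteq> cball 0 (r + s)"
proof
  fix z :: 'a assume "z \<in> cball 0 r + cball 0 s"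
  then obtain a b where "z = a + b" "norm a \<le> r" "norm b \<le> s"
    by (auto elim!: set_plus_elim)
  then show "z \<in> cball 0 (r + s)" using norm_triangle_ineq[of a b] by simp
qed

lemma measure_mean_body_plus_cball:
  fixes \<mu> :: "(real^'d) measure"
  assumes M: "prob_space \<mu>" and sets: "sets \<mu> = sets borel" and int: "integrable \<mu> (\<lambda>x. x)" and t: "0 < t"
  shows "measure lebesgue (mean_body \<mu> (\<lambda>x. x) + cball 0 t) = mean_steiner \<mu> (\<lambda>x. x) t"
proof -
  have space: "space \<mu> = UNIV" using sets_eq_imp_space_eq[OF sets] by simp
  have "\<exists>F. (\<forall>n. simple_function \<mu> (F n)) \<and> (\<forall>x\<in>space \<mu>. (\<lambda>n. F n x) \<longlonglongrightarrow> x) \<and>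
      (\<forall>n. \<forall>x\<in>space \<mu>. dist (F n x) 0 \<le> 2 * dist x 0)"
    by (rule borel_measurable_implies_sequence_metric) (simp add: sets measurable_ident_sets)
  then obtain \<phi> where simple: "\<And>n. simple_function \<mu> (\<phi> n)"
    and lim: "\<And>x. (\<lambda>n. \<phi> n x) \<longlonglongrightarrow> x" and bound: "\<And>n x. norm (\<phi> n x) \<le> 2 * norm x"
    by (auto simp: space)
  have meas: "\<phi> n \<in> borel_measurable \<mu>" for n
    using simple by (rule borel_measurable_simple_function)
  have \<phi>: "integrable \<mu> (\<phi> n)" for n
    by (rule Bochner_Integration.integrable_bound[OF integrable_scaleR_right[OF int, of 2]])
      (auto simp: meas bound)
  note [measurable] = meas
  define e where "e n = (LINT x|\<mu>. norm (\<phi> n x - x))" for n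
  have e_nonneg: "0 \<le> e n" for n by (simp add: e_def)
  have id_meas [measurable]: "(\<lambda>x. x) \<in> borel_measurable \<mu>" by (simp add: sets measurable_ident_sets)
  have "e \<longlonglongrightarrow> (LINT x|\<mu>. 0)"
    unfolding e_def
  proof (rule integral_dominated_convergence)
    \<comment> \<open>The constant is \<open>2 + 1\<close>, from the bound on the approximants and
      the triangle inequality.\<close>
    show "integrable \<mu> (\<lambda>x. 3 * norm x)" using int by simp
    show "(\<lambda>x. norm (\<phi> n x - x)) \<in> borel_measurable \<mu>" for n
      by measurable
    show "AE x in \<mu>. (\<lambda>n. norm (\<phi> n x - x)) \<longlonglongrightarrow> 0"
      using lim by (intro AE_I2) (simp add: tendsto_norm_zero LIM_zero)
    show "AE x in \<mu>. norm (norm (\<phi> n x - x)) \<le> 3 * norm x" for n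
    proof (rule AE_I2)
      fix x show "norm (norm (\<phi> n x - x)) \<le> 3 * norm x"
        using norm_triangle_ineq4[of "\<phi> n x" x] bound[of n x] by simp
    qed
  qed simp
  then have e_lim: "e \<longlonglongrightarrow> 0" by simp
  let ?K = "mean_body \<mu> (\<lambda>x. x)" and ?L = "\<lambda>n. mean_body \<mu> (\<phi> n)"
  have K: "convex_body ?K" and L: "convex_body (?L n)" for n
    using int \<phi> by (auto intro: convex_body_mean_body)
  have K_sub: "?K \<subseteq> ?L n + cball 0 (e n)" and L_sub: "?L n \<subseteq> ?K + cball 0 (e n)" for n
    using mean_body_subset[OF int \<phi>, of n] mean_body_subset[OF \<phi> int, of n]
    by (simp_all add: e_def norm_minus_commute)
  \<comment> \<open>The radius varies with \<open>n\<close> because the two inequalities use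
    \<open>t + e n\<close> and \<open>t - e n\<close>.\<close>
  have conv: "(\<lambda>n. mean_steiner \<mu> (\<phi> n) (s n)) \<longlonglongrightarrow> mean_steiner \<mu> (\<lambda>x. x) t" if "s \<longlonglongrightarrow> t" for s
    unfolding mean_steiner_def
    by (intro tendsto_intros that tendsto_mean_gram[OF M sets int meas lim bound]) simp
  show ?thesis
  proof (rule antisym)
    have "measure lebesgue (?K + cball 0 t) \<le> mean_steiner \<mu> (\<phi> n) (t + e n)" for n
    proof -
      have "?K + cball 0 t \<subseteq> ?L n + (cball 0 (e n) + cball 0 t)"
        using K_sub[of n] by (subst add.assoc[symmetric]) (intro set_plus_mono2 order_refl)
      also have "\<dots> \<subseteq> ?L n + cball 0 (t + e n)"
        using cball_plus_cball[of "e n" t] e_nonneg t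
        by (intro set_plus_mono2) (auto simp: add.commute)
      finally have "measure lebesgue (?K + cball 0 t) \<le> measure lebesgue (?L n + cball 0 (t + e n))"
        using K L e_nonneg[of n] t by (intro measure_mono_convex_body convex_body_set_plus) auto
      also have "\<dots> = mean_steiner \<mu> (\<phi> n) (t + e n)"
        using e_nonneg[of n] t by (intro measure_mean_body_simple_function M simple \<phi>) simp
      finally show ?thesis .
    qed
    moreover have "(\<lambda>n. t + e n) \<longlonglongrightarrow> t" using tendsto_add[OF tendsto_const e_lim] by simp
    ultimately show "measure lebesgue (?K + cball 0 t) \<le> mean_steiner \<mu> (\<lambda>x. x) t"
      by (intro LIMSEQ_le_const[OF conv]) auto
  next
    \<comment> \<open>The formula for simple functions requires a positive radius, which
      \<open>t - e n\<close> is for all large \<open>n\<close>.\<close>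
    have "mean_steiner \<mu> (\<phi> n) (t - e n) \<le> measure lebesgue (?K + cball 0 t)" if n: "e n < t" for n
    proof -
      have "?L n + cball 0 (t - e n) \<subseteq> ?K + (cball 0 (e n) + cball 0 (t - e n))"
        using L_sub[of n] by (subst add.assoc[symmetric]) (intro set_plus_mono2 order_refl)
      also have "\<dots> \<subseteq> ?K + cball 0 t"
        using cball_plus_cball[of "e n" "t - e n"] e_nonneg n
        by (intro set_plus_mono2) auto
      finally have "measure lebesgue (?L n + cball 0 (t - e n)) \<le> measure lebesgue (?K + cball 0 t)"
        using K L n t by (intro measure_mono_convex_body convex_body_set_plus) auto
      moreover have "measure lebesgue (?L n + cball 0 (t - e n)) = mean_steiner \<mu> (\<phi> n) (t - e n)"
        using n by (intro measure_mean_body_simple_function M simple \<phi>) simp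
      ultimately show ?thesis by simp
    qed
    moreover have "eventually (\<lambda>n. e n < t) sequentially"
      using e_lim t by (rule order_tendstoD)
    ultimately have "eventually (\<lambda>n. mean_steiner \<mu> (\<phi> n) (t - e n) \<le> measure lebesgue (?K + cball 0 t)) sequentially"
      by (auto elim: eventually_mono)
    moreover have "(\<lambda>n. t - e n) \<longlonglongrightarrow> t" using tendsto_diff[OF tendsto_const e_lim] by simp
    ultimately show "mean_steiner \<mu> (\<lambda>x. x) t \<le> measure lebesgue (?K + cball 0 t)"
      by (intro tendsto_upperbound[OF conv]) auto
  qed
qed

text \<open>For \<open>t = 0\<close> both sides are limits along radii decreasing to 0: the closed
  body is the intersection of its parallel bodies, so their volumes converge to its own, and the
  polynomial is continuous.\<close>

lemma steiner_formula_mean_body: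
  fixes \<mu> :: "(real^'d) measure"
  assumes M: "prob_space \<mu>" and sets: "sets \<mu> = sets borel" and int: "integrable \<mu> (\<lambda>x. x)"
  shows "steiner_formula (mean_body \<mu> (\<lambda>x. x)) (\<lambda>k. mean_gram \<mu> k (\<lambda>x. x) / fact k)"
proof -
  let ?K = "mean_body \<mu> (\<lambda>x. x)" and ?p = "mean_steiner \<mu> (\<lambda>x. x)"
  have K: "convex_body ?K" using int by (rule convex_body_mean_body)
  define r where "r n = inverse (real (Suc n))" for n
  have r: "0 < r n" for n by (simp add: r_def)
  have "(\<lambda>n. ?p (r n)) \<longlonglongrightarrow> ?p 0"
    unfolding mean_steiner_def r_def
    by (intro tendsto_sum tendsto_mult tendsto_power tendsto_const LIMSEQ_inverse_real_of_nat)
  moreover have "(\<lambda>n. measure lebesgue (?K + cball 0 (r n))) \<longlonglongrightarrow> measure lebesgue (\<Inter>n. ?K + cball 0 (r n))"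
  proof (rule Lim_measure_decseq)
    have lm: "?K + cball 0 (r n) \<in> lmeasurable" for n
      using K r[of n] by (intro convex_body_lmeasurable convex_body_set_plus) auto
    show "range (\<lambda>n. ?K + cball 0 (r n)) \<subseteq> sets lebesgue" using lm by (auto dest: fmeasurableD)
    show "emeasure lebesgue (?K + cball 0 (r n)) \<noteq> \<infinity>" for n using fmeasurableD2[OF lm] by simp
    show "decseq (\<lambda>n. ?K + cball 0 (r n))"
      by (intro decseq_SucI set_plus_mono2 order_refl subset_cball) (simp add: r_def field_simps)
  qed
  moreover have "(\<Inter>n. ?K + cball 0 (r n)) = ?K"
  proof (intro subset_antisym subsetI)
    fix z assume z: "z \<in> (\<Inter>n. ?K + cball 0 (r n))"
    have "z \<bullet> u \<le> (LINT x|\<mu>. max 0 (x \<bullet> u))" for u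
    proof (rule LIMSEQ_le_const)
      show "(\<lambda>n. (LINT x|\<mu>. max 0 (x \<bullet> u)) + r n * norm u) \<longlonglongrightarrow> (LINT x|\<mu>. max 0 (x \<bullet> u))"
        unfolding r_def
        by (rule tendsto_eq_intros LIMSEQ_inverse_real_of_nat refl | simp)+
      have "z \<bullet> u \<le> (LINT x|\<mu>. max 0 (x \<bullet> u)) + r n * norm u" for n
      proof -
        from z have "z \<in> ?K + cball 0 (r n)" by blast
        then obtain a b where ab: "z = a + b" "a \<in> ?K" "norm b \<le> r n"
          by (auto elim!: set_plus_elim)
        have "b \<bullet> u \<le> norm b * norm u" by (rule norm_cauchy_schwarz)
        also have "\<dots> \<le> r n * norm u" using ab by (intro mult_right_mono) auto
        finally show ?thesis using ab by (simp add: inner_add_left mean_body_def add_mono)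
      qed
      then show "\<exists>N. \<forall>n\<ge>N. z \<bullet> u \<le> (LINT x|\<mu>. max 0 (x \<bullet> u)) + r n * norm u" by blast
    qed
    then show "z \<in> ?K" by (simp add: mean_body_def)
  next
    fix z assume "z \<in> ?K"
    then show "z \<in> (\<Inter>n. ?K + cball 0 (r n))"
      using r subset_set_plus_left[of "cball 0 (r _)" ?K] by (auto simp: less_imp_le)
  qed
  ultimately have zero: "measure lebesgue ?K = ?p 0"
    using measure_mean_body_plus_cball[OF assms r] LIMSEQ_unique by auto
  have "measure lebesgue (?K + (\<lambda>x. t *\<^sub>R x) ` cball 0 1) = ?p t" if "t \<ge> 0" for t
  proof (cases "t = 0")
    case True
    have "(\<lambda>x. t *\<^sub>R x) ` cball 0 1 = ({0} :: (real^'d) set)" using True by (simp add: image_constant_conv)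
    then show ?thesis using zero True by (simp add: set_zero)
  next
    case False
    then show ?thesis
      using that measure_mean_body_plus_cball[OF assms, of t] by (simp add: cball_scale)
  qed
  then show ?thesis by (simp add: steiner_formula_def mean_steiner_def)
qed

text \<open>The Steiner formula involves all \<open>k\<close> at once and so uses index sets
  \<open>{..<k}\<close>, whereas the columns of a matrix are indexed by a type. A bijection carries
  one product measure to the other, and the Gram determinant does not see the relabelling.\<close>

lemma mean_gram_reindex:
  fixes \<mu> :: "'a::euclidean_space measure"
  assumes M: "prob_space \<mu>" and sets: "sets \<mu> = sets borel" and k: "CARD('j::finite) = k"
  shows "mean_gram \<mu> k (\<lambda>x. x) = (LINT x|PiM (UNIV :: 'j set) (\<lambda>_. \<mu>). sqrt (gram_det UNIV x))"
proof -
  obtain h where h: "bij_betw h {..<k} (UNIV :: 'j set)"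
    using k finite_same_card_bij[of "{..<k}" "UNIV :: 'j set"] by auto
  then have inj: "inj_on h {..<k}" and surj: "h ` {..<k} = UNIV" by (auto simp: bij_betw_def)
  let ?r = "\<lambda>\<omega>. \<lambda>n\<in>{..<k}. \<omega> (h n)"
  have distr: "distr (PiM UNIV (\<lambda>_. \<mu>)) (PiM {..<k} (\<lambda>_. \<mu>)) ?r = PiM {..<k} (\<lambda>_. \<mu>)"
    using distr_PiM_reindex[of UNIV "\<lambda>_. \<mu>" h "{..<k}"] M inj by simp
  have r: "?r \<in> measurable (PiM UNIV (\<lambda>_. \<mu>)) (PiM {..<k} (\<lambda>_. \<mu>))"
    by (intro measurable_restrict measurable_component_singleton) simp
  have coord: "(\<lambda>x. x i) \<in> borel_measurable (PiM {..<k} (\<lambda>_. \<mu>))" if "i < k" for i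
    using measurable_component_singleton[of i "{..<k}" "\<lambda>_. \<mu>"] that
    by (simp add: measurable_cong_sets[OF refl sets])
  have "(\<lambda>x. gram_det {..<k} x) \<in> borel_measurable (PiM {..<k} (\<lambda>_. \<mu>))"
    unfolding gram_det_def
    by (intro borel_measurable_sum borel_measurable_times borel_measurable_const
        borel_measurable_prod borel_measurable_inner coord)
      (use permutes_in_image[of _ "{..<k}"] in auto)
  then have "(\<lambda>x. sqrt (gram_det {..<k} x)) \<in> borel_measurable (PiM {..<k} (\<lambda>_. \<mu>))"
    by simp
  then have "mean_gram \<mu> k (\<lambda>x. x) =
      (LINT x|PiM UNIV (\<lambda>_. \<mu>). sqrt (gram_det {..<k} (?r x)))"
    unfolding mean_gram_def by (subst distr[symmetric]) (rule integral_distr[OF r])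
  also have "\<dots> = (LINT x|PiM (UNIV :: 'j set) (\<lambda>_. \<mu>). sqrt (gram_det UNIV x))"
  proof (rule Bochner_Integration.integral_cong[OF refl])
    fix x :: "'j \<Rightarrow> 'a"
    have "gram_det {..<k} (?r x) = gram_det {..<k} (x \<circ> h)" by (rule gram_det_cong) simp
    also have "\<dots> = gram_det UNIV x" using gram_det_reindex[OF inj, of x] surj by simp
    finally show "sqrt (gram_det {..<k} (?r x)) = sqrt (gram_det UNIV x)" by simp
  qed
  finally show ?thesis .
qed

theorem corollary2p2:
  fixes M :: "'w measure" and N :: "'v measure"
    and \<xi> :: "'w \<Rightarrow> real ^ 'd" and A :: "'v \<Rightarrow> real ^ 'j ^ 'd"
  assumes "prob_space M" and "integrable M \<xi>"
    and "CARD('j) \<le> CARD('d)"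
    and "prob_space N"
    and "prob_space.indep_vars N (\<lambda>_. borel) (\<lambda>k \<omega>. column k (A \<omega>)) UNIV"
    and "\<And>k. distr N borel (\<lambda>\<omega>. column k (A \<omega>)) = distr M borel \<xi>"
  shows "intrinsic_volume (selection_expectation M (\<lambda>\<omega>. closed_segment 0 (\<xi> \<omega>))) CARD('j) =
    1 / fact CARD('j) *
      prob_space.expectation N (\<lambda>\<omega>. sqrt (det (transpose (A \<omega>) ** A \<omega>)))"
proof -
  interpret M: prob_space M by fact
  interpret N: prob_space N by fact
  have \<xi> [measurable]: "\<xi> \<in> borel_measurable M" using assms(2) by simp
  \<comment> \<open>Only the law of \<open>\<xi>\<close> matters. On the space of values the
    identity takes the place of \<open>\<xi>\<close>, and the columns on \<open>N\<close> can be
    compared with it.\<close>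
  define \<mu> where "\<mu> = distr M borel \<xi>"
  have \<mu>: "prob_space \<mu>" "sets \<mu> = sets borel"
    using M.prob_space_distr[OF \<xi>] by (auto simp: \<mu>_def)
  have int: "integrable \<mu> (\<lambda>x. x)"
    using assms(2) by (simp add: \<mu>_def integrable_distr_eq)
  have "(LINT x|\<mu>. max 0 (x \<bullet> u)) = (LINT \<omega>|M. max 0 (\<xi> \<omega> \<bullet> u))" for u
    unfolding \<mu>_def by (rule integral_distr[OF \<xi>]) simp
  then have body: "mean_body M \<xi> = mean_body \<mu> (\<lambda>x. x)"
    by (simp add: mean_body_def)
  have col: "(\<lambda>\<omega>. column k (A \<omega>)) \<in> borel_measurable N" for k
    using assms(5) by (simp add: N.indep_vars_def)
  \<comment> \<open>Independence as a statement on the joint law: the columns together have the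
    product of their marginals, each of which is \<open>\<mu>\<close>.\<close>
  have "distr N (PiM UNIV (\<lambda>_. borel)) (\<lambda>\<omega> k. column k (A \<omega>)) = PiM UNIV (\<lambda>_::'j. \<mu>)"
    using N.indep_vars_iff_distr_eq_PiM[of UNIV "\<lambda>k \<omega>. column k (A \<omega>)" "\<lambda>_. borel"] col assms(5)
    by (simp add: restrict_UNIV assms(6) \<mu>_def)
  then have "(LINT x|PiM (UNIV :: 'j set) (\<lambda>_. \<mu>). sqrt (gram_det UNIV x)) =
      (LINT x|distr N (PiM UNIV (\<lambda>_. borel)) (\<lambda>\<omega> k. column k (A \<omega>)). sqrt (gram_det UNIV x))"
    by simp
  also have "\<dots> = (LINT \<omega>|N. sqrt (gram_det UNIV (\<lambda>k. column k (A \<omega>))))"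
  proof (rule integral_distr)
    show "(\<lambda>\<omega> k. column k (A \<omega>)) \<in> measurable N (PiM UNIV (\<lambda>_. borel))"
      using measurable_restrict[of UNIV "\<lambda>k \<omega>. column k (A \<omega>)" N "\<lambda>_. borel"] col
      by (simp add: restrict_UNIV)
    show "(\<lambda>x. sqrt (gram_det UNIV x)) \<in> borel_measurable (PiM (UNIV :: 'j set) (\<lambda>_. borel :: (real^'d) measure))"
      unfolding gram_det_def by measurable
  qed
  finally have "mean_gram \<mu> CARD('j) (\<lambda>x. x) = (LINT \<omega>|N. sqrt (det (transpose (A \<omega>) ** A \<omega>)))"
    by (simp add: mean_gram_reindex[OF \<mu> refl] gram_det_columns)
  then show ?thesis
    using intrinsic_volume_eqI[OF steiner_formula_mean_body[OF \<mu> int], of "CARD('j)"] assms(3)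
    by (simp add: selection_expectation_seg[OF assms(2)] body)
qed

end
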